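(* Let $A$ be a finite algebra. Then the following conditions are equivalent. (1) An irredundant non-refinable cover of $A$ consists of primal algebras (i.e. $A$ has an irredundant non-refinable cover $\mathcal U$ such that $A|_U$ is primal for every $U\in\mathcal U$). (2) $A$ is congruence primal and arithmetical.
   Context: For $n\in\mathbb N$ ($0\in\mathbb N$), an $n$-ary operation on a set $X$ is a map $X^n\to X$ ($n=0$ allowed). A clone on $X$ is a set of operations on $X$ containing all projections and closed under composition. An algebra is a pair $A=(A,\mathrm{Clo}(A))$ of a set and a clone on it; $\mathrm{Clo}_n(A)$ is the set of $n$-ary members of $\mathrm{Clo}(A)$. An $m$-ary relation $r\subset A^m$ is invariant if for every $n$ and every $f\in\mathrm{Clo}_n(A)$, applying $f$ coordinatewise to any $n$ tuples of $r$ gives a tuple of $r$; $\mathrm{Inv}(A)$ is the set of all invariant relations of $A$. A neighbourhood of $A$ is a set $U=e(A)$ for some $e\in\mathrm{Clo}_1(A)$ with $e\circ e=e$. For a neighbourhood $U$, $A|_U$ is the algebra on $U$ with $\mathrm{Clo}_n(A|_U)=\{t\restriction_{U^n}\mid t\in\mathrm{Clo}_n(A),\ t(U^n)\subset U\}$. A set $\mathcal U$ of neighbourhoods covers $A$ (is a cover of $A$) if for all $r,s\in\mathrm{Inv}(A)$ (of the same arity $m$), $r\cap U^m=s\cap U^m$ for all $U\in\mathcal U$ implies $r=s$. A cover is irredundant if no proper subset of it covers $A$. A cover $\mathcal U'$ is a refinement of a cover $\mathcal U$ if every $U'\in\mathcal U'$ is contained in some $U\in\mathcal U$; it is proper if moreover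 $\mathcal U$ is not a refinement of $\mathcal U'$. A cover is non-refinable if it has no proper refinement. (For finite $A$, irredundant non-refinable covers are unique up to isomorphism of their members, so "an" may be read as "some" or "every".) A finite algebra is primal if its clone consists of all operations (of all arities, including nullary) on its underlying set. A congruence of $A$ is an equivalence relation on $A$ belonging to $\mathrm{Inv}(A)$. A finite algebra $A$ is congruence primal if every operation on $A$ (of any arity, including nullary) preserving all congruences of $A$ belongs to $\mathrm{Clo}(A)$. $A$ is arithmetical if its congruence lattice is distributive and any two congruences of $A$ permute. *)

theory Defs
  imports "HOL-Library.FuncSet" "HOL-Library.NList" "HOL-Algebra.Lattice"
begin

text \<open>
  The \<open>n\<close>-tuples over \<open>X\<close> are the lists in \<^term>\<open>nlists n X\<close>. An \<open>n\<close>-ary operation is a function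
  on lists that is \<^term>\<open>undefined\<close> outside \<^term>\<open>nlists n X\<close>, so that equal operations are equal
  functions. Families of operations and relations are indexed by the arity, because
  over the empty set, and for the empty relation, the object does not determine its arity.
\<close>

definition ops :: "'a set \<Rightarrow> nat \<Rightarrow> ('a list \<Rightarrow> 'a) set" where
  "ops X n = nlists n X \<rightarrow>\<^sub>E X"

definition projection :: "'a set \<Rightarrow> nat \<Rightarrow> nat \<Rightarrow> 'a list \<Rightarrow> 'a" where
  "projection X n i = restrict (\<lambda>xs. xs ! i) (nlists n X)"

definition composition :: "'a set \<Rightarrow> nat \<Rightarrow> ('a list \<Rightarrow> 'a) \<Rightarrow> ('a list \<Rightarrow> 'a) list \<Rightarrow> 'a list \<Rightarrow> 'a" where
  "composition X m f gs = restrict (\<lambda>xs. f (map (\<lambda>g. g xs) gs)) (nlists m X)"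

definition clone_on :: "'a set \<Rightarrow> (nat \<Rightarrow> ('a list \<Rightarrow> 'a) set) \<Rightarrow> bool" where
  "clone_on X C \<longleftrightarrow>
     (\<forall>n. C n \<subseteq> ops X n) \<and>
     (\<forall>n. \<forall>i<n. projection X n i \<in> C n) \<and>
     (\<forall>n m. \<forall>f\<in>C n. \<forall>gs\<in>nlists n (C m). composition X m f gs \<in> C m)"

record 'a clone_algebra = "'a partial_object" +
  Clo :: "nat \<Rightarrow> ('a list \<Rightarrow> 'a) set"

definition is_algebra :: "'a clone_algebra \<Rightarrow> bool" where
  "is_algebra A \<longleftrightarrow> clone_on (carrier A) (Clo A)"

text \<open>
  \<open>ts\<close> is a list of \<open>n\<close> tuples of length \<open>m\<close>. The arity \<open>m\<close> has to be passed explicitly since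
  it cannot be read off \<open>ts\<close> when \<open>f\<close> is nullary.
\<close>

definition coordinatewise :: "nat \<Rightarrow> ('a list \<Rightarrow> 'a) \<Rightarrow> 'a list list \<Rightarrow> 'a list" where
  "coordinatewise m f ts = map (\<lambda>j. f (map (\<lambda>t. t ! j) ts)) [0..<m]"

definition preserves :: "nat \<Rightarrow> ('a list \<Rightarrow> 'a) \<Rightarrow> nat \<Rightarrow> 'a list set \<Rightarrow> bool" where
  "preserves n f m r \<longleftrightarrow> (\<forall>ts\<in>nlists n r. coordinatewise m f ts \<in> r)"

definition Inv :: "'a clone_algebra \<Rightarrow> nat \<Rightarrow> 'a list set set" where
  "Inv A m = {r. r \<subseteq> nlists m (carrier A) \<and> (\<forall>n. \<forall>f\<in>Clo A n. preserves n f m r)}"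

definition neighbourhood :: "'a clone_algebra \<Rightarrow> 'a set \<Rightarrow> bool" where
  "neighbourhood A U \<longleftrightarrow>
     (\<exists>e\<in>Clo A 1. (\<forall>x\<in>carrier A. e [e [x]] = e [x]) \<and> U = (\<lambda>x. e [x]) ` carrier A)"

definition induced_algebra :: "'a clone_algebra \<Rightarrow> 'a set \<Rightarrow> 'a clone_algebra" where
  "induced_algebra A U =
     \<lparr>carrier = U,
      Clo = (\<lambda>n. {restrict t (nlists n U) | t. t \<in> Clo A n \<and> t ` nlists n U \<subseteq> U})\<rparr>"

definition cover :: "'a clone_algebra \<Rightarrow> 'a set set \<Rightarrow> bool" where
  "cover A \<U> \<longleftrightarrow>
     (\<forall>U\<in>\<U>. neighbourhood A U) \<and>
     (\<forall>m. \<forall>r\<in>Inv A m. \<forall>s\<in>Inv A m.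
        (\<forall>U\<in>\<U>. r \<inter> nlists m U = s \<inter> nlists m U) \<longrightarrow> r = s)"

definition irredundant_cover :: "'a clone_algebra \<Rightarrow> 'a set set \<Rightarrow> bool" where
  "irredundant_cover A \<U> \<longleftrightarrow> cover A \<U> \<and> (\<forall>\<V>. \<V> \<subset> \<U> \<longrightarrow> \<not> cover A \<V>)"

definition refinement :: "'a set set \<Rightarrow> 'a set set \<Rightarrow> bool" where
  "refinement \<V> \<U> \<longleftrightarrow> (\<forall>V\<in>\<V>. \<exists>U\<in>\<U>. V \<subseteq> U)"

definition proper_refinement :: "'a set set \<Rightarrow> 'a set set \<Rightarrow> bool" where
  "proper_refinement \<V> \<U> \<longleftrightarrow> refinement \<V> \<U> \<and> \<not> refinement \<U> \<V>"

definition non_refinable_cover :: "'a clone_algebra \<Rightarrow> 'a set set \<Rightarrow> bool" where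
  "non_refinable_cover A \<U> \<longleftrightarrow>
     cover A \<U> \<and> \<not> (\<exists>\<V>. cover A \<V> \<and> proper_refinement \<V> \<U>)"

definition primal :: "'a clone_algebra \<Rightarrow> bool" where
  "primal A \<longleftrightarrow> finite (carrier A) \<and> (\<forall>n. Clo A n = ops (carrier A) n)"

definition pair_relation :: "('a \<times> 'a) set \<Rightarrow> 'a list set" where
  "pair_relation \<theta> = {[x, y] | x y. (x, y) \<in> \<theta>}"

definition Con :: "'a clone_algebra \<Rightarrow> ('a \<times> 'a) set set" where
  "Con A = {\<theta>. equiv (carrier A) \<theta> \<and> pair_relation \<theta> \<in> Inv A 2}"

definition congruence_primal :: "'a clone_algebra \<Rightarrow> bool" where
  "congruence_primal A \<longleftrightarrow>
     finite (carrier A) \<and>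
     (\<forall>n. \<forall>f\<in>ops (carrier A) n.
        (\<forall>\<theta>\<in>Con A. preserves n f 2 (pair_relation \<theta>)) \<longrightarrow> f \<in> Clo A n)"

definition congruence_lattice :: "'a clone_algebra \<Rightarrow> ('a \<times> 'a) set gorder" where
  "congruence_lattice A = \<lparr>carrier = Con A, eq = (=), le = (\<subseteq>)\<rparr>"

definition distributive_lattice :: "('a, 'b) gorder_scheme \<Rightarrow> bool" where
  "distributive_lattice L \<longleftrightarrow>
     lattice L \<and>
     (\<forall>x\<in>carrier L. \<forall>y\<in>carrier L. \<forall>z\<in>carrier L.
        x \<sqinter>\<^bsub>L\<^esub> (y \<squnion>\<^bsub>L\<^esub> z) = (x \<sqinter>\<^bsub>L\<^esub> y) \<squnion>\<^bsub>L\<^esub> (x \<sqinter>\<^bsub>L\<^esub> z))"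

definition arithmetical :: "'a clone_algebra \<Rightarrow> bool" where
  "arithmetical A \<longleftrightarrow>
     distributive_lattice (congruence_lattice A) \<and>
     (\<forall>\<theta>\<in>Con A. \<forall>\<phi>\<in>Con A. \<theta> O \<phi> = \<phi> O \<theta>)"

end

theory Submission imports Defs begin

text \<open>
  Both directions rest on interpolation along columns. Suppose that \<open>x\<close> is an
  \<open>m\<close>-tuple and that \<open>ys\<close> is a list of tuples of an invariant relation
  \<open>r\<close>, so that each coordinate \<open>j < m\<close> gives a column of
  \<open>ys\<close>. If the clone contains an operation that sends the \<open>j\<close>-th column to
  \<open>x ! j\<close> for every \<open>j\<close>, then \<open>x\<close> belongs to
  \<open>r\<close>.

  Why a primal cover suffices: on a primal neighbourhood every such interpolation is possible as
  long as it is well defined, so the restriction of an invariant relation to it is given by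
  equalities between coordinates (\<open>primal_neighbourhood_interpolation\<close>). In particular
  an invariant binary relation restricts to the equality or to the full relation
  (\<open>compatible_restriction\<close>). Because restriction to a neighbourhood respects intersections and
  relational products, and a cover detects inclusions, every law that holds for these two
  relations holds for all invariant binary relations: they are congruences, they
  permute, and they distribute. Moreover every invariant relation is the set of tuples whose pairs
  of coordinates lie in its binary projections (\<open>Inv_determined_by_pairs\<close>), which are congruences.
  Applied to the relation formed by the value tables of \<open>Clo A n\<close>, this shows that an operation
  preserving all congruences is in the clone.

  Why a primal cover exists: in the finite distributive lattice of congruences, each inclusion
  \<open>\<phi> \<subseteq> \<theta>\<close> that fails is witnessed by a splitting pair \<open>(\<alpha>, \<beta>)\<close>, where \<open>\<alpha>\<close> is join prime and \<open>\<beta>\<close> is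
  the largest congruence not above \<open>\<alpha>\<close> (\<open>exists_splitting\<close>). For \<open>(a, b) \<in> \<alpha> - \<beta>\<close>, any operation
  with values in \<open>{a, b}\<close> that respects \<open>\<beta>\<close>-classes preserves all congruences and is therefore in
  the clone. Hence \<open>{a, b}\<close> is a neighbourhood, and it carries a primal algebra. Choosing one such
  pair for each join prime \<open>\<alpha>\<close> gives a cover (\<open>separating_cover\<close>): the required interpolating
  operation is compatible with the congruences on the columns where it is prescribed, and the
  Chinese remainder theorem for permuting distributive congruences extends it to all tuples
  (\<open>extend_compatible\<close>). The cover is irredundant and non-refinable
  because the other chosen sets and the sets with at most one element cannot tell
  that \<open>\<alpha>\<close> is not contained in \<open>\<beta>\<close> (\<open>not_cover\<close>).

  Over the empty carrier there are no constants, and the cover is the singleton of the empty set;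
  this case is treated separately.
\<close>

section \<open>Tuples and equivalence relations\<close>

(* As rewrite rules these two have extra variables in their premises and make the simplifier
   diverge as soon as membership in nlists is itself rewritten. *)
declare nlistsE_length [simp del] nlistsE_set [simp del]

lemma nlists_iff: "xs \<in> nlists n A \<longleftrightarrow> length xs = n \<and> set xs \<subseteq> A"
  unfolding nlists_def by blast

lemma finite_nlists: "finite X \<Longrightarrow> finite (nlists n X)"
  by (rule finite_subset[OF _ finite_lists_length_eq[of X n]]) (auto simp: nlists_iff)

lemma coordinatewise_2:
  "coordinatewise 2 f ts = [f (map (\<lambda>t. t ! 0) ts), f (map (\<lambda>t. t ! 1) ts)]"
  by (simp add: coordinatewise_def upt_rec)

lemma length_coordinatewise [simp]: "length (coordinatewise m f ts) = m"
  by (simp add: coordinatewise_def)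

lemma nth_coordinatewise [simp]:
  "j < m \<Longrightarrow> coordinatewise m f ts ! j = f (map (\<lambda>t. t ! j) ts)"
  by (simp add: coordinatewise_def)

lemma pair_mem_pair_relation [simp]: "[x, y] \<in> pair_relation \<theta> \<longleftrightarrow> (x, y) \<in> \<theta>"
  by (simp add: pair_relation_def)

text \<open>
  A list of pairs in \<open>\<theta>\<close> is the same as a pair of lists related componentwise, which is the
  form in which relational products, converses and intersections are easy to handle.
\<close>

lemma preserves_pair_relation:
  "preserves n f 2 (pair_relation \<theta>) \<longleftrightarrow>
     (\<forall>xs ys. length xs = n \<longrightarrow> (xs, ys) \<in> listrel \<theta> \<longrightarrow> (f xs, f ys) \<in> \<theta>)"
proof (intro iffI allI impI)
  fix xs ys assume pres: "preserves n f 2 (pair_relation \<theta>)"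
    and xy: "length xs = n" "(xs, ys) \<in> listrel \<theta>"
  define ts where "ts = map (\<lambda>i. [xs ! i, ys ! i]) [0..<n]"
  have len: "length ys = n" using xy by (simp add: listrel_iff_nth)
  have "ts \<in> nlists n (pair_relation \<theta>)"
    using xy by (auto simp: ts_def nlists_iff listrel_iff_nth)
  then have "coordinatewise 2 f ts \<in> pair_relation \<theta>" using pres by (simp add: preserves_def)
  moreover have "map (\<lambda>t. t ! 0) ts = xs" "map (\<lambda>t. t ! 1) ts = ys"
    using xy(1) len by (auto simp: ts_def intro!: nth_equalityI)
  ultimately show "(f xs, f ys) \<in> \<theta>" by (simp add: coordinatewise_2 del: One_nat_def)
next
  assume pres: "\<forall>xs ys. length xs = n \<longrightarrow> (xs, ys) \<in> listrel \<theta> \<longrightarrow> (f xs, f ys) \<in> \<theta>"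
  show "preserves n f 2 (pair_relation \<theta>)"
    unfolding preserves_def
  proof
    fix ts assume ts: "ts \<in> nlists n (pair_relation \<theta>)"
    have "(map (\<lambda>t. t ! 0) ts, map (\<lambda>t. t ! 1) ts) \<in> listrel \<theta>"
    proof -
      have "(ts ! i ! 0, ts ! i ! 1) \<in> \<theta>" if "i < length ts" for i
      proof -
        have "ts ! i \<in> pair_relation \<theta>" using ts that nlistsE_nth_in[OF ts] by (simp add: nlists_iff)
        then show ?thesis by (auto simp: pair_relation_def)
      qed
      then show ?thesis by (simp add: listrel_iff_nth)
    qed
    then show "coordinatewise 2 f ts \<in> pair_relation \<theta>"
      using pres ts by (simp add: coordinatewise_2 nlists_iff)
  qed
qed

lemma equiv_comp:
  assumes "equiv X \<theta>" "equiv X \<phi>" and comm: "\<theta> O \<phi> = \<phi> O \<theta>"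
  shows "equiv X (\<theta> O \<phi>)"
proof (rule equivI)
  note eqs = assms(1,2)[unfolded equiv_def]
  show "\<theta> O \<phi> \<subseteq> X \<times> X" using eqs by blast
  show "refl_on X (\<theta> O \<phi>)" using eqs unfolding refl_on_def by blast
  have "(\<theta> O \<phi>)\<inverse> = \<phi> O \<theta>" using eqs by (simp add: converse_relcomp sym_conv_converse_eq)
  then show "sym (\<theta> O \<phi>)" using comm by (simp add: sym_conv_converse_eq)
  have "(\<theta> O \<phi>) O (\<theta> O \<phi>) = \<theta> O (\<phi> O \<theta>) O \<phi>" by (simp add: O_assoc)
  also have "\<dots> = \<theta> O (\<theta> O \<phi>) O \<phi>" by (simp only: comm)
  also have "\<dots> = (\<theta> O \<theta>) O (\<phi> O \<phi>)" by (simp add: O_assoc)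
  also have "\<dots> \<subseteq> \<theta> O \<phi>" using eqs by (intro relcomp_mono) (simp_all add: trans_O_subset)
  finally show "trans (\<theta> O \<phi>)" unfolding trans_def by blast
qed

lemma equiv_Inter:
  assumes "S \<noteq> {}" "\<And>\<theta>. \<theta> \<in> S \<Longrightarrow> equiv X \<theta>"
  shows "equiv X (\<Inter>S)"
proof (rule equivI)
  show "\<Inter>S \<subseteq> X \<times> X" using assms equiv_type by blast
  show "refl_on X (\<Inter>S)" using assms(2) by (auto simp: equiv_def refl_on_def)
  show "sym (\<Inter>S)" using assms(2) by (auto simp: equiv_def sym_def)
  show "trans (\<Inter>S)" using assms(2) unfolding equiv_def trans_def by blast
qed

lemma equiv_comp_upper:
  assumes "equiv X \<theta>" "equiv X \<phi>"
  shows "\<theta> \<subseteq> \<theta> O \<phi>" and "\<phi> \<subseteq> \<theta> O \<phi>"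
proof -
  note eqs = assms[unfolded equiv_def refl_on_def]
  show "\<theta> \<subseteq> \<theta> O \<phi>" using eqs by (intro subrelI) blast
  show "\<phi> \<subseteq> \<theta> O \<phi>" using eqs by (intro subrelI) blast
qed

lemma equiv_comp_least:
  assumes "equiv X \<psi>" "\<theta> \<subseteq> \<psi>" "\<phi> \<subseteq> \<psi>"
  shows "\<theta> O \<phi> \<subseteq> \<psi>"
proof -
  have "\<theta> O \<phi> \<subseteq> \<psi> O \<psi>" using assms(2,3) by (rule relcomp_mono)
  also have "\<dots> \<subseteq> \<psi>" using assms(1) by (simp add: equiv_def trans_O_subset)
  finally show ?thesis .
qed

section \<open>Distributive families of permuting equivalences\<close>

text \<open>
  The abstract form of the congruences of an arithmetical algebra. Two equivalences permute exactly
  when their relational product is an equivalence, so permutability is contained in closure under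
  products; the product is then the join, and \<open>distrib\<close> is the distributive law.
\<close>

locale arithmetical_equivalences =
  fixes X :: "'a set" and E :: "('a \<times> 'a) set set"
  assumes finite_base: "finite X"
    and equivalence: "\<theta> \<in> E \<Longrightarrow> equiv X \<theta>"
    and top_mem: "X \<times> X \<in> E"
    and Inter_mem: "S \<subseteq> E \<Longrightarrow> S \<noteq> {} \<Longrightarrow> \<Inter>S \<in> E"
    and comp_mem: "\<theta> \<in> E \<Longrightarrow> \<phi> \<in> E \<Longrightarrow> \<theta> O \<phi> \<in> E"
    and distrib: "\<theta> \<in> E \<Longrightarrow> \<phi> \<in> E \<Longrightarrow> \<psi> \<in> E \<Longrightarrow>
      \<theta> \<inter> (\<phi> O \<psi>) \<subseteq> (\<theta> \<inter> \<phi>) O (\<theta> \<inter> \<psi>)"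
begin

lemma inter_mem: "\<theta> \<in> E \<Longrightarrow> \<phi> \<in> E \<Longrightarrow> \<theta> \<inter> \<phi> \<in> E"
  using Inter_mem[of "{\<theta>, \<phi>}"] by simp

lemma in_base: "\<theta> \<in> E \<Longrightarrow> (x, y) \<in> \<theta> \<Longrightarrow> x \<in> X \<and> y \<in> X"
  by (drule equivalence, drule equiv_type) blast

lemma reflexive: "\<theta> \<in> E \<Longrightarrow> x \<in> X \<Longrightarrow> (x, x) \<in> \<theta>"
  by (drule equivalence) (simp add: equiv_def refl_on_def)

lemma symmetric: "\<theta> \<in> E \<Longrightarrow> (x, y) \<in> \<theta> \<Longrightarrow> (y, x) \<in> \<theta>"
  by (drule equivalence) (simp add: equiv_def sym_def)

lemma transitive: "\<theta> \<in> E \<Longrightarrow> (x, y) \<in> \<theta> \<Longrightarrow> (y, z) \<in> \<theta> \<Longrightarrow> (x, z) \<in> \<theta>"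
  by (drule equivalence) (unfold equiv_def trans_def, blast)

lemma finite_family: "finite E"
proof -
  have "E \<subseteq> Pow (X \<times> X)" using equiv_type[OF equivalence] by blast
  then show ?thesis by (rule finite_subset) (simp add: finite_base)
qed

text \<open>
  The usual passage from one distributive law to its dual, with joins written as products.
\<close>

lemma dual_distrib:
  assumes "\<theta> \<in> E" "\<phi> \<in> E" "\<psi> \<in> E"
  shows "(\<theta> O \<psi>) \<inter> (\<phi> O \<psi>) \<subseteq> (\<theta> \<inter> \<phi>) O \<psi>"
proof -
  have "(\<theta> O \<psi>) \<inter> (\<phi> O \<psi>) \<subseteq> ((\<theta> O \<psi>) \<inter> \<phi>) O ((\<theta> O \<psi>) \<inter> \<psi>)"
    using distrib[OF comp_mem[OF assms(1,3)] assms(2,3)] .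
  also have "\<dots> \<subseteq> ((\<phi> \<inter> \<theta>) O (\<phi> \<inter> \<psi>)) O \<psi>"
    using distrib[OF assms(2,1,3)] by blast
  also have "\<dots> \<subseteq> (\<theta> \<inter> \<phi>) O \<psi>"
    using transitive[OF assms(3)] by blast
  finally show ?thesis .
qed

lemma finite_dual_distrib:
  assumes "finite I" "\<And>i. i \<in> I \<Longrightarrow> \<Theta> i \<in> E" "\<psi> \<in> E"
    and "\<And>i. i \<in> I \<Longrightarrow> (x, y) \<in> \<Theta> i O \<psi>" and "x \<in> X" "y \<in> X"
  shows "\<exists>\<theta>\<in>E. (x, y) \<in> \<theta> O \<psi> \<and> (\<forall>i\<in>I. \<theta> \<subseteq> \<Theta> i)"
  using assms
proof (induction I rule: finite_induct)
  case empty
  have "(x, y) \<in> (X \<times> X) O \<psi>"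
    using empty.prems reflexive[of \<psi> y] by (intro relcompI[of x y]) auto
  then show ?case by (intro bexI[OF _ top_mem]) simp
next
  case (insert i I)
  have "\<exists>\<theta>\<in>E. (x, y) \<in> \<theta> O \<psi> \<and> (\<forall>i\<in>I. \<theta> \<subseteq> \<Theta> i)"
    using insert.prems by (intro insert.IH) blast+
  then obtain \<theta> where \<theta>: "\<theta> \<in> E" "(x, y) \<in> \<theta> O \<psi>" "\<forall>i\<in>I. \<theta> \<subseteq> \<Theta> i" by blast
  have "(x, y) \<in> (\<theta> \<inter> \<Theta> i) O \<psi>"
    using dual_distrib[of \<theta> "\<Theta> i" \<psi>] \<theta>(1,2) insert.prems(1)[of i] insert.prems(2)
      insert.prems(3)[of i] by blast
  moreover have "\<theta> \<inter> \<Theta> i \<in> E" using \<theta>(1) insert.prems(1)[of i] inter_mem by blast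
  ultimately show ?case using \<theta>(3) by (intro bexI[of _ "\<theta> \<inter> \<Theta> i"]) auto
qed

text \<open>
  Given a solution \<open>v\<close> for the first congruences, \<open>v\<close> is related to the next residue by
  \<open>\<Theta> i O \<Theta> k\<close> for every earlier \<open>i\<close>; by the dual distributive law it is so by the product of a common
  refinement of the \<open>\<Theta> i\<close> with \<open>\<Theta> k\<close>, and the intermediate point is the new solution.
\<close>

lemma chinese_remainder:
  assumes "finite I" "X \<noteq> {}" "\<And>i. i \<in> I \<Longrightarrow> \<Theta> i \<in> E" "\<And>i. i \<in> I \<Longrightarrow> c i \<in> X"
    and "\<And>i j. i \<in> I \<Longrightarrow> j \<in> I \<Longrightarrow> (c i, c j) \<in> \<Theta> i O \<Theta> j"
  shows "\<exists>v\<in>X. \<forall>i\<in>I. (c i, v) \<in> \<Theta> i"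
  using assms
proof (induction I rule: finite_induct)
  case empty
  then show ?case by blast
next
  case (insert k I)
  then obtain v where v: "v \<in> X" "\<forall>i\<in>I. (c i, v) \<in> \<Theta> i" by auto
  have "(v, c k) \<in> \<Theta> i O \<Theta> k" if "i \<in> I" for i
  proof -
    have "(c i, c k) \<in> \<Theta> i O \<Theta> k" "(v, c i) \<in> \<Theta> i"
      using insert.prems that v symmetric by auto
    then show ?thesis using transitive insert.prems(2) that by (meson insertI2 relcomp.simps)
  qed
  then obtain \<theta> where \<theta>: "\<theta> \<in> E" "(v, c k) \<in> \<theta> O \<Theta> k" "\<forall>i\<in>I. \<theta> \<subseteq> \<Theta> i"
    using finite_dual_distrib[of I \<Theta> "\<Theta> k" v "c k"] insert v by auto
  then obtain w where w: "(v, w) \<in> \<theta>" "(w, c k) \<in> \<Theta> k" by blast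
  have "(c i, w) \<in> \<Theta> i" if "i \<in> I" for i
    using v \<theta> w that insert.prems(2) transitive by blast
  moreover have "(c k, w) \<in> \<Theta> k" using w symmetric insert.prems by blast
  moreover have "w \<in> X" using in_base w \<theta> by blast
  ultimately show ?case by blast
qed

definition compatible_on :: "'a list set \<Rightarrow> ('a list \<Rightarrow> 'a) \<Rightarrow> bool" where
  "compatible_on D f \<longleftrightarrow>
     (\<forall>\<theta>\<in>E. \<forall>xs\<in>D. \<forall>ys\<in>D. (xs, ys) \<in> listrel \<theta> \<longrightarrow> (f xs, f ys) \<in> \<theta>)"

lemma listrel_symmetric: "\<theta> \<in> E \<Longrightarrow> (xs, ys) \<in> listrel \<theta> \<Longrightarrow> (ys, xs) \<in> listrel \<theta>"
  using symmetric by (simp add: listrel_iff_nth)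

text \<open>
  Admissible values at a new point are the solutions of a system of congruences, one for each old
  point, and compatibility of \<open>f\<close> makes the system pairwise solvable.
\<close>

lemma extend_compatible_to_point:
  assumes "X \<noteq> {}" "D \<subseteq> nlists n X" "p \<in> nlists n X" "p \<notin> D" "f ` D \<subseteq> X" "compatible_on D f"
  shows "\<exists>v\<in>X. compatible_on (insert p D) (f(p := v))"
proof -
  \<comment> \<open>\<open>T d\<close> is the least member of \<open>E\<close> that identifies \<open>d\<close> and \<open>p\<close>; the value at \<open>p\<close> has to
    agree with \<open>f d\<close> modulo it.\<close>
  define T where "T d = \<Inter>{\<theta> \<in> E. (d, p) \<in> listrel \<theta>}" for d
  have top: "(d, p) \<in> listrel (X \<times> X)" if "d \<in> D" for d
  proof -
    have "d \<in> nlists n X" using that assms(2) by blast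
    then show ?thesis
      using assms(3) nlistsE_nth_in[of _ n X] by (simp add: listrel_iff_nth nlistsE_length)
  qed
  have TE: "T d \<in> E" if "d \<in> D" for d
    unfolding T_def using top[OF that] top_mem by (intro Inter_mem) auto
  have Tp: "(d, p) \<in> listrel (T d)" if "d \<in> D" for d
    using top[OF that] by (auto simp: T_def listrel_iff_nth)
  have "\<exists>v\<in>X. \<forall>d\<in>D. (f d, v) \<in> T d"
  proof (rule chinese_remainder)
    show "finite D" using finite_nlists[OF finite_base] assms(2) finite_subset by blast
    fix d d' assume d: "d \<in> D" "d' \<in> D"
    have "(d, d') \<in> listrel (T d O T d')"
      using Tp[OF d(1)] listrel_symmetric[OF TE Tp, OF d(2,2)]
      unfolding listrel_iff_nth by (metis relcompI)
    then show "(f d, f d') \<in> T d O T d'"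
      using assms(6) comp_mem[OF TE TE] d unfolding compatible_on_def by blast
  qed (use assms TE in auto)
  then obtain v where v: "v \<in> X" "\<And>d. d \<in> D \<Longrightarrow> (f d, v) \<in> T d" by blast
  have *: "(f d, v) \<in> \<theta>" if "\<theta> \<in> E" "d \<in> D" "(d, p) \<in> listrel \<theta>" for \<theta> d
    using v(2)[OF that(2)] that by (auto simp: T_def)
  have "compatible_on (insert p D) (f(p := v))"
    unfolding compatible_on_def
  proof (intro ballI impI)
    fix \<theta> xs ys assume a: "\<theta> \<in> E" "xs \<in> insert p D" "ys \<in> insert p D" "(xs, ys) \<in> listrel \<theta>"
    consider "xs = p" "ys = p" | "xs = p" "ys \<in> D" | "xs \<in> D" "ys = p" | "xs \<in> D" "ys \<in> D"
      using a by blast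
    then show "((f(p := v)) xs, (f(p := v)) ys) \<in> \<theta>"
    proof cases
      case 1
      then show ?thesis using reflexive[OF a(1) v(1)] by simp
    next
      case 2
      then have "(f ys, v) \<in> \<theta>" using * a(1,4) listrel_symmetric by blast
      then have "(v, f ys) \<in> \<theta>" using symmetric[OF a(1)] by blast
      moreover have "ys \<noteq> p" using 2 assms(4) by blast
      ultimately show ?thesis using 2 by simp
    next
      case 3
      then have "(f xs, v) \<in> \<theta>" using * a(1,4) by blast
      moreover have "xs \<noteq> p" using 3 assms(4) by blast
      ultimately show ?thesis using 3 by simp
    next
      case 4
      then have "(f xs, f ys) \<in> \<theta>" using a(1,4) assms(6) by (simp add: compatible_on_def)
      moreover have "xs \<noteq> p" "ys \<noteq> p" using 4 assms(4) by blast+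
      ultimately show ?thesis by simp
    qed
  qed
  with v show ?thesis by blast
qed

lemma extend_compatible:
  assumes "X \<noteq> {}" "D \<subseteq> nlists n X" "f ` D \<subseteq> X" "compatible_on D f"
  shows "\<exists>g. g ` nlists n X \<subseteq> X \<and> compatible_on (nlists n X) g \<and> (\<forall>xs\<in>D. g xs = f xs)"
proof -
  have "\<exists>g. g ` (D \<union> P) \<subseteq> X \<and> compatible_on (D \<union> P) g \<and> (\<forall>xs\<in>D. g xs = f xs)"
    if "finite P" "P \<subseteq> nlists n X" for P
    using that
  proof (induction P rule: finite_induct)
    case empty
    then show ?case using assms by auto
  next
    case (insert p P)
    then obtain g where g: "g ` (D \<union> P) \<subseteq> X" "compatible_on (D \<union> P) g" "\<forall>xs\<in>D. g xs = f xs"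
      by auto
    show ?case
    proof (cases "p \<in> D \<union> P")
      case True
      then show ?thesis using g by (auto simp: insert_absorb)
    next
      case False
      then obtain v where v: "v \<in> X" "compatible_on (insert p (D \<union> P)) (g(p := v))"
        using extend_compatible_to_point[of "D \<union> P" n p g] assms insert.prems g by auto
      have "(g(p := v)) ` (D \<union> insert p P) \<subseteq> X" "\<forall>xs\<in>D. (g(p := v)) xs = f xs"
        using v(1) g(1,3) False by auto
      then show ?thesis using v(2) by (metis Un_insert_right)
    qed
  qed
  from this[OF finite_nlists[OF finite_base] order_refl] show ?thesis using assms(2) by (simp add: Un_absorb1)
qed

text \<open>
  The pair \<open>(\<alpha>, \<beta>)\<close> divides the lattice into the principal filter of \<open>\<alpha>\<close> and the principal ideal of
  \<open>\<beta>\<close>.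
\<close>

definition splitting :: "('a \<times> 'a) set \<Rightarrow> ('a \<times> 'a) set \<Rightarrow> bool" where
  "splitting \<alpha> \<beta> \<longleftrightarrow> \<alpha> \<in> E \<and> \<beta> \<in> E \<and> \<not> \<alpha> \<subseteq> \<beta> \<and> (\<forall>\<theta>\<in>E. \<alpha> \<subseteq> \<theta> \<or> \<theta> \<subseteq> \<beta>)"

text \<open>
  A minimal \<open>\<alpha>\<close> below \<open>\<phi>\<close> but not below \<open>\<theta>\<close> has all its proper lower bounds below \<open>\<theta>\<close>, hence is join
  irreducible. Distributivity turns this into join primeness, so that the members of \<open>E\<close> not above \<open>\<alpha>\<close>
  have a largest element \<open>\<beta>\<close>.
\<close>

lemma exists_splitting:
  assumes "\<phi> \<in> E" "\<theta> \<in> E" "\<not> \<phi> \<subseteq> \<theta>"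
  obtains \<alpha> \<beta> where "splitting \<alpha> \<beta>" "\<alpha> \<subseteq> \<phi>" "\<not> \<alpha> \<subseteq> \<theta>"
proof -
  define S where "S = {\<alpha> \<in> E. \<alpha> \<subseteq> \<phi> \<and> \<not> \<alpha> \<subseteq> \<theta>}"
  have S: "finite S" "\<phi> \<in> S" using finite_family assms by (auto simp: S_def)
  obtain \<alpha> where \<alpha>: "\<alpha> \<in> S" and min: "\<forall>\<psi>\<in>S. \<psi> \<subseteq> \<alpha> \<longrightarrow> \<alpha> = \<psi>"
    using finite_has_minimal[OF S(1)] S(2) by auto
  have \<alpha>E: "\<alpha> \<in> E" "\<alpha> \<subseteq> \<phi>" "\<not> \<alpha> \<subseteq> \<theta>" using \<alpha> by (auto simp: S_def)
  have below: "\<psi> \<subseteq> \<theta>" if "\<psi> \<in> E" "\<psi> \<subset> \<alpha>" for \<psi>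
    using min that \<alpha>E by (auto simp: S_def)
  define T where "T = {\<beta> \<in> E. \<not> \<alpha> \<subseteq> \<beta>}"
  have T: "finite T" "\<theta> \<in> T" using finite_family assms \<alpha>E by (auto simp: T_def)
  obtain \<beta> where \<beta>: "\<beta> \<in> T" and max: "\<forall>\<psi>\<in>T. \<beta> \<subseteq> \<psi> \<longrightarrow> \<beta> = \<psi>"
    using finite_has_maximal[OF T(1)] T(2) by auto
  have \<beta>E: "\<beta> \<in> E" "\<not> \<alpha> \<subseteq> \<beta>" using \<beta> by (auto simp: T_def)
  have "\<psi> \<subseteq> \<beta>" if \<psi>: "\<psi> \<in> E" "\<not> \<alpha> \<subseteq> \<psi>" for \<psi>
  proof (rule ccontr)
    assume "\<not> \<psi> \<subseteq> \<beta>"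
    then have "\<beta> \<noteq> \<beta> O \<psi>" "\<beta> \<subseteq> \<beta> O \<psi>" using equiv_comp_upper[OF equivalence[OF \<beta>E(1)] equivalence[OF \<psi>(1)]] by auto
    then have "\<alpha> \<subseteq> \<beta> O \<psi>" using max comp_mem[OF \<beta>E(1) \<psi>(1)] unfolding T_def by blast
    then have "\<alpha> \<subseteq> (\<alpha> \<inter> \<beta>) O (\<alpha> \<inter> \<psi>)" using distrib[OF \<alpha>E(1) \<beta>E(1) \<psi>(1)] by blast
    also have "\<dots> \<subseteq> \<theta>"
      using \<psi> \<alpha>E \<beta>E inter_mem
      by (intro equiv_comp_least[OF equivalence[OF assms(2)]] below) auto
    finally show False using \<alpha>E by blast
  qed
  then have "splitting \<alpha> \<beta>" using \<alpha>E \<beta>E by (auto simp: splitting_def)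
  with \<alpha>E that show thesis by blast
qed

end

section \<open>Compatible binary relations and congruences\<close>

definition compatible :: "'a clone_algebra \<Rightarrow> ('a \<times> 'a) set \<Rightarrow> bool" where
  "compatible A \<theta> \<longleftrightarrow> pair_relation \<theta> \<in> Inv A 2"

lemma compatible_iff:
  "compatible A \<theta> \<longleftrightarrow> \<theta> \<subseteq> carrier A \<times> carrier A \<and>
     (\<forall>n. \<forall>f\<in>Clo A n. \<forall>xs ys. length xs = n \<longrightarrow> (xs, ys) \<in> listrel \<theta> \<longrightarrow> (f xs, f ys) \<in> \<theta>)"
proof -
  have "pair_relation \<theta> \<subseteq> nlists 2 (carrier A) \<longleftrightarrow> \<theta> \<subseteq> carrier A \<times> carrier A"
    by (auto simp: pair_relation_def nlists_iff)
  then show ?thesis by (simp add: compatible_def Inv_def preserves_pair_relation)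
qed

lemma Con_iff: "\<theta> \<in> Con A \<longleftrightarrow> equiv (carrier A) \<theta> \<and> compatible A \<theta>"
  by (simp add: Con_def compatible_def)

lemma Inv_closed:
  "r \<in> Inv A m \<Longrightarrow> f \<in> Clo A n \<Longrightarrow> ts \<in> nlists n r \<Longrightarrow> coordinatewise m f ts \<in> r"
  by (auto simp: Inv_def preserves_def)

lemma listrel_comp: "listrel (\<theta> O \<phi>) \<subseteq> listrel \<theta> O listrel \<phi>"
proof (rule subrelI)
  fix xs zs assume "(xs, zs) \<in> listrel (\<theta> O \<phi>)"
  then show "(xs, zs) \<in> listrel \<theta> O listrel \<phi>"
    by (induction rule: listrel.induct) (blast intro: listrel.intros)+
qed

lemma compatible_comp:
  assumes "compatible A \<theta>" "compatible A \<phi>"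
  shows "compatible A (\<theta> O \<phi>)"
  unfolding compatible_iff
proof (intro conjI allI ballI impI)
  show "\<theta> O \<phi> \<subseteq> carrier A \<times> carrier A" using assms by (auto simp: compatible_iff)
  fix n f xs zs assume f: "f \<in> Clo A n" "length xs = n" "(xs, zs) \<in> listrel (\<theta> O \<phi>)"
  then obtain ys where "(xs, ys) \<in> listrel \<theta>" "(ys, zs) \<in> listrel \<phi>"
    using listrel_comp by blast
  moreover from this have "length ys = n" using f by (simp add: listrel_iff_nth)
  ultimately have "(f xs, f ys) \<in> \<theta>" "(f ys, f zs) \<in> \<phi>"
    using assms f unfolding compatible_iff by blast+
  then show "(f xs, f zs) \<in> \<theta> O \<phi>" by blast
qed

lemma compatible_Inter:
  assumes "S \<noteq> {}" "\<And>\<theta>. \<theta> \<in> S \<Longrightarrow> compatible A \<theta>"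
  shows "compatible A (\<Inter>S)"
  unfolding compatible_iff
proof (intro conjI allI ballI impI)
  show "\<Inter>S \<subseteq> carrier A \<times> carrier A" using assms by (auto simp: compatible_iff)
  fix n f xs ys assume f: "f \<in> Clo A n" "length xs = n" "(xs, ys) \<in> listrel (\<Inter>S)"
  show "(f xs, f ys) \<in> \<Inter>S"
  proof
    fix \<theta> assume \<theta>: "\<theta> \<in> S"
    then have "(xs, ys) \<in> listrel \<theta>" using f(3) listrel_mono[of "\<Inter>S" \<theta>] by blast
    then show "(f xs, f ys) \<in> \<theta>" using assms(2)[OF \<theta>] f by (simp add: compatible_iff)
  qed
qed

lemma compatible_Int: "compatible A \<theta> \<Longrightarrow> compatible A \<phi> \<Longrightarrow> compatible A (\<theta> \<inter> \<phi>)"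
  using compatible_Inter[of "{\<theta>, \<phi>}" A] by auto

lemma compatible_converse:
  assumes "compatible A \<theta>"
  shows "compatible A (\<theta>\<inverse>)"
  unfolding compatible_iff
proof (intro conjI allI ballI impI)
  show "\<theta>\<inverse> \<subseteq> carrier A \<times> carrier A" using assms by (auto simp: compatible_iff)
  fix n f xs ys assume f: "f \<in> Clo A n" "length xs = n" "(xs, ys) \<in> listrel (\<theta>\<inverse>)"
  then have "(ys, xs) \<in> listrel \<theta>" "length ys = n" by (auto simp: listrel_iff_nth)
  then show "(f xs, f ys) \<in> \<theta>\<inverse>" using assms f by (simp add: compatible_iff)
qed

lemma Con_Inter: "S \<subseteq> Con A \<Longrightarrow> S \<noteq> {} \<Longrightarrow> \<Inter>S \<in> Con A"
  by (auto simp: Con_iff intro!: equiv_Inter compatible_Inter)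

lemma Con_Int: "\<theta> \<in> Con A \<Longrightarrow> \<phi> \<in> Con A \<Longrightarrow> \<theta> \<inter> \<phi> \<in> Con A"
  using Con_Inter[of "{\<theta>, \<phi>}"] by simp

lemma Con_comp: "\<theta> \<in> Con A \<Longrightarrow> \<phi> \<in> Con A \<Longrightarrow> \<theta> O \<phi> = \<phi> O \<theta> \<Longrightarrow> \<theta> O \<phi> \<in> Con A"
  by (simp add: Con_iff equiv_comp compatible_comp)

lemma Clo_closed: "is_algebra A \<Longrightarrow> f \<in> Clo A n \<Longrightarrow> xs \<in> nlists n (carrier A) \<Longrightarrow> f xs \<in> carrier A"
  by (auto simp: is_algebra_def clone_on_def ops_def)

lemma compatible_Id_on:
  assumes "is_algebra A"
  shows "compatible A (Id_on (carrier A))"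
  unfolding compatible_iff
proof (intro conjI allI ballI impI)
  fix n f xs ys assume f: "f \<in> Clo A n" "length xs = n" "(xs, ys) \<in> listrel (Id_on (carrier A))"
  then have len: "length xs = n" "length ys = n"
    and eq: "\<And>i. i < n \<Longrightarrow> xs ! i = ys ! i \<and> xs ! i \<in> carrier A"
    by (auto simp: listrel_iff_nth)
  then have "xs = ys" "xs \<in> nlists n (carrier A)"
    by (auto simp: nlists_iff set_conv_nth intro: nth_equalityI)
  then show "(f xs, f ys) \<in> Id_on (carrier A)" using Clo_closed[OF assms f(1)] by (simp add: Id_on_iff)
qed auto

lemma carrier_square_Con:
  assumes "is_algebra A"
  shows "carrier A \<times> carrier A \<in> Con A"
proof -
  have "compatible A (carrier A \<times> carrier A)"
    unfolding compatible_iff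
  proof (intro conjI allI ballI impI)
    fix n f xs ys
    assume f: "f \<in> Clo A n" "length xs = n" "(xs, ys) \<in> listrel (carrier A \<times> carrier A)"
    then have "xs \<in> nlists n (carrier A)" "ys \<in> nlists n (carrier A)"
      by (auto simp: listrel_iff_nth nlists_iff set_conv_nth)
    then show "(f xs, f ys) \<in> carrier A \<times> carrier A" using Clo_closed[OF assms f(1)] by simp
  qed auto
  moreover have "equiv (carrier A) (carrier A \<times> carrier A)"
    by (auto simp: equiv_def refl_on_def sym_def trans_def)
  ultimately show ?thesis by (simp add: Con_iff)
qed

section \<open>Permuting congruence lattices\<close>

lemma carrier_congruence_lattice [simp]: "carrier (congruence_lattice A) = Con A"
  and le_congruence_lattice [simp]: "\<theta> \<sqsubseteq>\<^bsub>congruence_lattice A\<^esub> \<phi> \<longleftrightarrow> \<theta> \<subseteq> \<phi>"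
  and eq_congruence_lattice [simp]: "\<theta> .=\<^bsub>congruence_lattice A\<^esub> \<phi> \<longleftrightarrow> \<theta> = \<phi>"
  by (simp_all add: congruence_lattice_def)

text \<open>
  When congruences permute, relational products are congruences and hence joins; this connects the
  abstract lattice operations with relations.
\<close>

lemma permuting_congruence_lattice:
  assumes comm: "\<forall>\<theta>\<in>Con A. \<forall>\<phi>\<in>Con A. \<theta> O \<phi> = \<phi> O \<theta>"
  shows "lattice (congruence_lattice A)"
    and "\<And>\<theta> \<phi>. \<theta> \<in> Con A \<Longrightarrow> \<phi> \<in> Con A \<Longrightarrow> \<theta> \<squnion>\<^bsub>congruence_lattice A\<^esub> \<phi> = \<theta> O \<phi>"
    and "\<And>\<theta> \<phi>. \<theta> \<in> Con A \<Longrightarrow> \<phi> \<in> Con A \<Longrightarrow> \<theta> \<sqinter>\<^bsub>congruence_lattice A\<^esub> \<phi> = \<theta> \<inter> \<phi>"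
proof -
  let ?L = "congruence_lattice A"
  have comp: "\<theta> O \<phi> \<in> Con A" "\<theta> \<subseteq> \<theta> O \<phi>" "\<phi> \<subseteq> \<theta> O \<phi>" if "\<theta> \<in> Con A" "\<phi> \<in> Con A" for \<theta> \<phi>
  proof -
    show "\<theta> O \<phi> \<in> Con A" using that comm by (intro Con_comp) auto
    show "\<theta> \<subseteq> \<theta> O \<phi>" "\<phi> \<subseteq> \<theta> O \<phi>"
      using that equiv_comp_upper[of "carrier A" \<theta> \<phi>] by (simp_all add: Con_iff)
  qed
  have least: "\<theta> O \<phi> \<subseteq> \<psi>" if "\<psi> \<in> Con A" "\<theta> \<subseteq> \<psi>" "\<phi> \<subseteq> \<psi>" for \<theta> \<phi> \<psi>
    using that equiv_comp_least[of "carrier A" \<psi>] by (simp add: Con_iff)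
  show L: "lattice ?L"
  proof (unfold_locales, simp_all)
    fix \<theta> \<phi> assume in_Con: "\<theta> \<in> Con A" "\<phi> \<in> Con A"
    have "least ?L (\<theta> O \<phi>) (Upper ?L {\<theta>, \<phi>})"
      using comp[OF in_Con] least in_Con by (auto simp: least_def Upper_def)
    then show "\<exists>s. least ?L s (Upper ?L {\<theta>, \<phi>})" ..
    have "greatest ?L (\<theta> \<inter> \<phi>) (Lower ?L {\<theta>, \<phi>})"
      using in_Con Con_Int[OF in_Con] by (auto simp: greatest_def Lower_def)
    then show "\<exists>s. greatest ?L s (Lower ?L {\<theta>, \<phi>})" ..
  qed (auto simp: fun_eq_iff)
  interpret lattice ?L by (rule L)
  fix \<theta> \<phi> assume in_Con: "\<theta> \<in> Con A" "\<phi> \<in> Con A"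
  show "\<theta> \<squnion>\<^bsub>?L\<^esub> \<phi> = \<theta> O \<phi>"
  proof
    show "\<theta> \<squnion>\<^bsub>?L\<^esub> \<phi> \<subseteq> \<theta> O \<phi>" using join_le[of \<theta> "\<theta> O \<phi>" \<phi>] comp[OF in_Con] in_Con by simp
    show "\<theta> O \<phi> \<subseteq> \<theta> \<squnion>\<^bsub>?L\<^esub> \<phi>"
      using least join_closed[of \<theta> \<phi>] join_left[of \<theta> \<phi>] join_right[of \<theta> \<phi>] in_Con by simp
  qed
  show "\<theta> \<sqinter>\<^bsub>?L\<^esub> \<phi> = \<theta> \<inter> \<phi>"
    using meet_le[of "\<theta> \<inter> \<phi>" \<theta> \<phi>] meet_left[of \<theta> \<phi>] meet_right[of \<theta> \<phi>] Con_Int[OF in_Con] in_Con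
    by auto
qed

lemma arithmetical_equivalences_Con:
  assumes "is_algebra A" "finite (carrier A)" and "arithmetical A"
  shows "arithmetical_equivalences (carrier A) (Con A)"
proof -
  let ?L = "congruence_lattice A"
  have comm: "\<forall>\<theta>\<in>Con A. \<forall>\<phi>\<in>Con A. \<theta> O \<phi> = \<phi> O \<theta>" using assms(3) by (simp add: arithmetical_def)
  note ops = permuting_congruence_lattice(2,3)[OF comm]
  show ?thesis
  proof
    show "carrier A \<times> carrier A \<in> Con A"
      by (rule carrier_square_Con[OF assms(1)])
    fix \<theta> \<phi> \<psi> assume in_Con: "\<theta> \<in> Con A" "\<phi> \<in> Con A" "\<psi> \<in> Con A"
    have "\<theta> \<sqinter>\<^bsub>?L\<^esub> (\<phi> \<squnion>\<^bsub>?L\<^esub> \<psi>) = (\<theta> \<sqinter>\<^bsub>?L\<^esub> \<phi>) \<squnion>\<^bsub>?L\<^esub> (\<theta> \<sqinter>\<^bsub>?L\<^esub> \<psi>)"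
      using assms(3) in_Con by (simp add: arithmetical_def distributive_lattice_def)
    then show "\<theta> \<inter> (\<phi> O \<psi>) \<subseteq> (\<theta> \<inter> \<phi>) O (\<theta> \<inter> \<psi>)"
      using in_Con comm by (simp add: ops Con_Int Con_comp)
  qed (use assms(2) comm in \<open>simp_all add: Con_Inter Con_comp, simp add: Con_def\<close>)
qed

lemma arithmeticalI:
  assumes comm: "\<forall>\<theta>\<in>Con A. \<forall>\<phi>\<in>Con A. \<theta> O \<phi> = \<phi> O \<theta>"
    and distrib: "\<And>\<theta> \<phi> \<psi>. \<theta> \<in> Con A \<Longrightarrow> \<phi> \<in> Con A \<Longrightarrow> \<psi> \<in> Con A \<Longrightarrow>
      \<theta> \<inter> (\<phi> O \<psi>) \<subseteq> (\<theta> \<inter> \<phi>) O (\<theta> \<inter> \<psi>)"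
  shows "arithmetical A"
proof -
  note ops = permuting_congruence_lattice[OF comm]
  have "\<theta> \<inter> (\<phi> O \<psi>) = (\<theta> \<inter> \<phi>) O (\<theta> \<inter> \<psi>)"
    if "\<theta> \<in> Con A" "\<phi> \<in> Con A" "\<psi> \<in> Con A" for \<theta> \<phi> \<psi>
  proof
    have "(\<theta> \<inter> \<phi>) O (\<theta> \<inter> \<psi>) \<subseteq> \<theta>"
      using that(1) equiv_comp_least[of "carrier A" \<theta>] by (simp add: Con_iff)
    then show "(\<theta> \<inter> \<phi>) O (\<theta> \<inter> \<psi>) \<subseteq> \<theta> \<inter> (\<phi> O \<psi>)" by blast
  qed (rule distrib[OF that])
  then show ?thesis
    using comm ops(1) by (simp add: arithmetical_def distributive_lattice_def ops(2,3) Con_Int Con_comp)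
qed

section \<open>Covers by primal neighbourhoods\<close>

lemma neighbourhood_subset:
  assumes "is_algebra A" "neighbourhood A U"
  shows "U \<subseteq> carrier A"
  using assms(2) Clo_closed[OF assms(1)] by (auto simp: neighbourhood_def nlists_iff)

lemma neighbourhood_retraction:
  assumes "neighbourhood A U"
  obtains e where "e \<in> Clo A 1" "\<And>x. x \<in> carrier A \<Longrightarrow> e [x] \<in> U" "\<And>u. u \<in> U \<Longrightarrow> e [u] = u"
  using assms unfolding neighbourhood_def by auto

text \<open>
  Covers are defined by detecting equality of invariant relations. They also detect inclusion, since
  invariant relations are closed under intersection.
\<close>

lemma cover_subset:
  assumes "cover A \<U>" "r \<in> Inv A m" "s \<in> Inv A m"
    and "\<And>U. U \<in> \<U> \<Longrightarrow> r \<inter> nlists m U \<subseteq> s"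
  shows "r \<subseteq> s"
proof -
  have "r \<inter> s \<in> Inv A m"
    using assms(2,3) unfolding Inv_def preserves_def
    by (auto simp: nlists_iff)
  moreover have "\<forall>U\<in>\<U>. (r \<inter> s) \<inter> nlists m U = r \<inter> nlists m U" using assms(4) by blast
  ultimately have "r \<inter> s = r" using assms(1,2) unfolding cover_def by blast
  then show ?thesis by blast
qed

lemma cover_compatible_subset:
  assumes "cover A \<U>" "compatible A \<theta>" "compatible A \<phi>"
    and "\<And>U. U \<in> \<U> \<Longrightarrow> \<theta> \<inter> U \<times> U \<subseteq> \<phi>"
  shows "\<theta> \<subseteq> \<phi>"
proof -
  have "pair_relation \<theta> \<subseteq> pair_relation \<phi>"
  proof (rule cover_subset[OF assms(1)])
    fix U assume "U \<in> \<U>"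
    then show "pair_relation \<theta> \<inter> nlists 2 U \<subseteq> pair_relation \<phi>"
      using assms(4) by (auto simp: pair_relation_def nlists_iff)
  qed (use assms(2,3) in \<open>simp_all add: compatible_def\<close>)
  then show ?thesis by (auto simp: pair_relation_def)
qed

text \<open>
  The tuple \<open>x\<close> is the value of an operation at the list of all tuples of \<open>r\<close> over \<open>U\<close>: sending
  the column of index \<open>j\<close> to \<open>x ! j\<close> is well defined by \<open>sep\<close>, and primality provides the operation.
  Nonemptiness of \<open>U\<close> is needed for a value outside the columns.
\<close>

lemma primal_neighbourhood_interpolation:
  assumes fin: "finite (carrier A)" and alg: "is_algebra A"
    and U: "neighbourhood A U" "U \<noteq> {}" "primal (induced_algebra A U)"
    and r: "r \<in> Inv A m" and x: "x \<in> nlists m U"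
    and sep: "\<And>i j. i < m \<Longrightarrow> j < m \<Longrightarrow> \<forall>y\<in>r \<inter> nlists m U. y ! i = y ! j \<Longrightarrow> x ! i = x ! j"
  shows "x \<in> r"
proof -
  have "finite U" using neighbourhood_subset[OF alg U(1)] fin finite_subset by blast
  then have "finite (r \<inter> nlists m U)" using finite_nlists by blast
  then obtain ys where ys: "set ys = r \<inter> nlists m U" using finite_list by blast
  define n where "n = length ys"
  define column where "column j = map (\<lambda>y. y ! j) ys" for j
  obtain c where c: "c \<in> U" using U(2) by blast
  define index where "index us = (SOME j. j < m \<and> us = column j)" for us
  define g where
    "g = restrict (\<lambda>us. if \<exists>j<m. us = column j then x ! index us else c) (nlists n U)"
  have xU: "x ! j \<in> U" if "j < m" for j using nlistsE_nth_in[OF x that] .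
  have col: "column j \<in> nlists n U" if "j < m" for j
    using ys that nlistsE_nth_in by (fastforce simp: column_def n_def nlists_iff)
  have g_col: "g (column j) = x ! j" if "j < m" for j
  proof -
    have k: "index (column j) < m" "column j = column (index (column j))"
      using someI[of "\<lambda>k. k < m \<and> column j = column k" j] that unfolding index_def by simp_all
    then have "\<forall>y\<in>set ys. y ! index (column j) = y ! j"
      unfolding column_def map_eq_conv by simp
    then have "x ! index (column j) = x ! j" using sep[OF k(1) that] ys by blast
    then show ?thesis using col[OF that] that unfolding g_def by auto
  qed
  have "g \<in> ops U n"
    unfolding ops_def
  proof (rule PiE_I)
    fix us assume us: "us \<in> nlists n U"
    show "g us \<in> U"
    proof (cases "\<exists>j<m. us = column j")
      case True then show ?thesis using g_col xU by auto
    next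
      case False then show ?thesis using us c by (auto simp: g_def)
    qed
  qed (simp add: g_def)
  then have "g \<in> Clo (induced_algebra A U) n"
    using U(3) by (simp add: primal_def induced_algebra_def)
  then obtain t where t: "t \<in> Clo A n" "g = restrict t (nlists n U)"
    by (auto simp: induced_algebra_def)
  have "coordinatewise m t ys \<in> r"
    using ys by (intro Inv_closed[OF r t(1)]) (auto simp: nlists_iff n_def)
  moreover have "coordinatewise m t ys = x"
  proof (rule nth_equalityI)
    fix j assume "j < length (coordinatewise m t ys)"
    then have j: "j < m" by simp
    have "t (column j) = g (column j)" using t(2) col[OF j] by simp
    then show "coordinatewise m t ys ! j = x ! j" using j g_col[OF j] by (simp add: column_def)
  qed (use x in \<open>simp add: nlists_iff\<close>)
  ultimately show ?thesis by simp
qed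

text \<open>
  A primal neighbourhood admits only these two restrictions of a compatible relation. The lemmas
  about them collect the laws that a primal cover transfers to the whole algebra.
\<close>

lemma trivial_relation:
  assumes "T = Id_on U \<or> T = U \<times> U"
  shows "Id_on U \<subseteq> T" and "T\<inverse> = T" and "T O T = T"
proof -
  show "Id_on U \<subseteq> T" using assms by (elim disjE) (hypsubst, blast)+
  show "T\<inverse> = T" using assms by (elim disjE) (simp_all, blast)
  show "T O T = T" using assms by (elim disjE) (hypsubst, blast)+
qed

lemma trivial_relations:
  assumes "T = Id_on U \<or> T = U \<times> U" "P = Id_on U \<or> P = U \<times> U" "S = Id_on U \<or> S = U \<times> U"
  shows "T O P = P O T" and "T \<inter> (P O S) \<subseteq> (T \<inter> P) O (T \<inter> S)"
proof -
  show "T O P = P O T" using assms(1,2) by (elim disjE) (hypsubst, blast)+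
  show "T \<inter> (P O S) \<subseteq> (T \<inter> P) O (T \<inter> S)"
    using assms by (elim disjE) (hypsubst, blast)+
qed

locale primal_cover =
  fixes A :: "'a clone_algebra" and \<U> :: "'a set set"
  assumes alg: "is_algebra A" and fin: "finite (carrier A)" and nonempty: "carrier A \<noteq> {}"
    and cov: "cover A \<U>"
    and prim: "U \<in> \<U> \<Longrightarrow> primal (induced_algebra A U)"
begin

lemma nbhd: "U \<in> \<U> \<Longrightarrow> neighbourhood A U"
  using cov by (simp add: cover_def)

lemma member_nonempty: "U \<in> \<U> \<Longrightarrow> U \<noteq> {}"
  using nbhd nonempty unfolding neighbourhood_def by blast

text \<open>
  If \<open>\<theta>\<close> contains a pair of distinct elements of \<open>U\<close>, no equality between the two coordinates
  holds on \<open>U\<close>, and interpolation produces every pair.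
\<close>

lemma compatible_restriction:
  assumes "compatible A \<theta>" "U \<in> \<U>"
  shows "\<theta> \<inter> U \<times> U = Id_on U \<or> \<theta> \<inter> U \<times> U = U \<times> U"
proof -
  have *: "(u, v) \<in> \<theta>" if uv: "u \<in> U" "v \<in> U" "u = v \<or> (\<exists>a b. (a, b) \<in> \<theta> \<inter> U \<times> U \<and> a \<noteq> b)" for u v
  proof -
    have "[u, v] \<in> pair_relation \<theta>"
    proof (rule primal_neighbourhood_interpolation[OF fin alg nbhd member_nonempty prim])
      show "pair_relation \<theta> \<in> Inv A 2" using assms(1) by (simp add: compatible_def)
      show "[u, v] \<in> nlists 2 U" using uv by (simp add: nlists_iff)
      fix i j :: nat assume ij: "i < 2" "j < 2"
        and eq: "\<forall>y\<in>pair_relation \<theta> \<inter> nlists 2 U. y ! i = y ! j"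
      show "[u, v] ! i = [u, v] ! j"
      proof (cases "u = v \<or> i = j")
        case True
        then show ?thesis using ij by (auto simp: less_2_cases_iff)
      next
        case False
        then obtain a b where ab: "(a, b) \<in> \<theta>" "a \<in> U" "b \<in> U" "a \<noteq> b" using uv(3) by blast
        then have "[a, b] \<in> pair_relation \<theta> \<inter> nlists 2 U" by (simp add: nlists_iff)
        with eq have "[a, b] ! i = [a, b] ! j" by (rule bspec)
        then show ?thesis using False ij ab(4) by (auto simp: less_2_cases_iff)
      qed
    qed (use assms(2) in simp_all)
    then show ?thesis by simp
  qed
  show ?thesis
  proof (cases "\<exists>a b. (a, b) \<in> \<theta> \<inter> U \<times> U \<and> a \<noteq> b")
    case True
    then have "U \<times> U \<subseteq> \<theta>" using * by auto
    then show ?thesis by blast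
  next
    case False
    moreover have "Id_on U \<subseteq> \<theta>" using * by auto
    ultimately show ?thesis by auto
  qed
qed

text \<open>
  The nontrivial inclusion moves the intermediate element into \<open>U\<close> by the retraction onto \<open>U\<close>.
\<close>

lemma comp_restriction:
  assumes "compatible A \<theta>" "compatible A \<phi>" "U \<in> \<U>"
  shows "\<theta> O \<phi> \<inter> U \<times> U = (\<theta> \<inter> U \<times> U) O (\<phi> \<inter> U \<times> U)"
proof
  obtain e where e: "e \<in> Clo A 1" "\<And>x. x \<in> carrier A \<Longrightarrow> e [x] \<in> U" "\<And>u. u \<in> U \<Longrightarrow> e [u] = u"
    using neighbourhood_retraction[OF nbhd[OF assms(3)]] by blast
  have e_pres: "(e [x], e [y]) \<in> \<psi>" if "compatible A \<psi>" "(x, y) \<in> \<psi>" for x y \<psi>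
  proof -
    have "([x], [y]) \<in> listrel \<psi>" using that(2) by (intro listrel.intros)
    then show ?thesis using that(1) e(1) by (simp add: compatible_iff)
  qed
  show "\<theta> O \<phi> \<inter> U \<times> U \<subseteq> (\<theta> \<inter> U \<times> U) O (\<phi> \<inter> U \<times> U)"
  proof (rule subrelI)
    fix x z assume "(x, z) \<in> \<theta> O \<phi> \<inter> U \<times> U"
    then obtain y where y: "(x, y) \<in> \<theta>" "(y, z) \<in> \<phi>" and U: "x \<in> U" "z \<in> U" by blast
    have "y \<in> carrier A" using y assms(1) by (auto simp: compatible_iff)
    moreover have "(x, e [y]) \<in> \<theta>" using e_pres[OF assms(1) y(1)] U e(3) by simp
    moreover have "(e [y], z) \<in> \<phi>" using e_pres[OF assms(2) y(2)] U e(3) by simp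
    ultimately show "(x, z) \<in> (\<theta> \<inter> U \<times> U) O (\<phi> \<inter> U \<times> U)" using U e(2) by blast
  qed
qed blast

text \<open>
  Reflexivity, symmetry and transitivity are inclusions between compatible relations, so it is
  enough to verify them on the members of the cover.
\<close>

lemma compatible_Con:
  assumes \<theta>: "compatible A \<theta>"
  shows "\<theta> \<in> Con A"
proof -
  have "Id_on (carrier A) \<subseteq> \<theta>"
  proof (rule cover_compatible_subset[OF cov compatible_Id_on[OF alg] \<theta>])
    fix U assume U: "U \<in> \<U>"
    have "Id_on (carrier A) \<inter> U \<times> U \<subseteq> Id_on U" by blast
    also have "\<dots> \<subseteq> \<theta>" using trivial_relation(1)[OF compatible_restriction[OF \<theta> U]] by simp
    finally show "Id_on (carrier A) \<inter> U \<times> U \<subseteq> \<theta>" .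
  qed
  moreover have "\<theta>\<inverse> \<subseteq> \<theta>"
  proof (rule cover_compatible_subset[OF cov compatible_converse[OF \<theta>] \<theta>])
    fix U assume U: "U \<in> \<U>"
    have "\<theta>\<inverse> \<inter> U \<times> U = (\<theta> \<inter> U \<times> U)\<inverse>" by blast
    also have "\<dots> = \<theta> \<inter> U \<times> U" using compatible_restriction[OF \<theta> U] by (rule trivial_relation(2))
    finally show "\<theta>\<inverse> \<inter> U \<times> U \<subseteq> \<theta>" by blast
  qed
  moreover have "\<theta> O \<theta> \<subseteq> \<theta>"
  proof (rule cover_compatible_subset[OF cov compatible_comp[OF \<theta> \<theta>] \<theta>])
    fix U assume U: "U \<in> \<U>"
    show "\<theta> O \<theta> \<inter> U \<times> U \<subseteq> \<theta>"
      using comp_restriction[OF \<theta> \<theta> U]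
        trivial_relation(3)[OF compatible_restriction[OF \<theta> U]] by simp
  qed
  moreover have "\<theta> \<subseteq> carrier A \<times> carrier A" using \<theta> by (simp add: compatible_iff)
  ultimately have "equiv (carrier A) \<theta>"
    unfolding equiv_def refl_on_def sym_def trans_def by blast
  then show ?thesis using \<theta> by (simp add: Con_iff)
qed

lemma permute_Con:
  assumes "\<theta> \<in> Con A" "\<phi> \<in> Con A"
  shows "\<theta> O \<phi> \<subseteq> \<phi> O \<theta>"
proof -
  have c: "compatible A \<theta>" "compatible A \<phi>" using assms by (simp_all add: Con_iff)
  show ?thesis
  proof (rule cover_compatible_subset[OF cov compatible_comp[OF c] compatible_comp[OF c(2,1)]])
    fix U assume U: "U \<in> \<U>"
    have "(\<theta> \<inter> U \<times> U) O (\<phi> \<inter> U \<times> U) = (\<phi> \<inter> U \<times> U) O (\<theta> \<inter> U \<times> U)"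
      by (rule trivial_relations(1)[OF compatible_restriction[OF c(1) U]
          compatible_restriction[OF c(2) U] compatible_restriction[OF c(2) U]])
    then have "\<theta> O \<phi> \<inter> U \<times> U = \<phi> O \<theta> \<inter> U \<times> U"
      unfolding comp_restriction[OF c U] comp_restriction[OF c(2,1) U] .
    then show "\<theta> O \<phi> \<inter> U \<times> U \<subseteq> \<phi> O \<theta>" by (simp only: Int_lower1)
  qed
qed

lemma distrib_Con:
  assumes "\<theta> \<in> Con A" "\<phi> \<in> Con A" "\<psi> \<in> Con A"
  shows "\<theta> \<inter> (\<phi> O \<psi>) \<subseteq> (\<theta> \<inter> \<phi>) O (\<theta> \<inter> \<psi>)"
proof -
  have c: "compatible A \<theta>" "compatible A \<phi>" "compatible A \<psi>"
    using assms by (simp_all add: Con_iff)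
  note ci = compatible_Int[OF c(1,2)] compatible_Int[OF c(1,3)]
  show ?thesis
  proof (rule cover_compatible_subset[OF cov compatible_Int[OF c(1) compatible_comp[OF c(2,3)]]
        compatible_comp[OF ci]])
    fix U assume U: "U \<in> \<U>"
    define T P S where TPS: "T = \<theta> \<inter> U \<times> U" "P = \<phi> \<inter> U \<times> U" "S = \<psi> \<inter> U \<times> U"
    have "T \<inter> (P O S) \<subseteq> (T \<inter> P) O (T \<inter> S)"
      unfolding TPS by (rule trivial_relations(2)[OF compatible_restriction[OF c(1) U]
          compatible_restriction[OF c(2) U] compatible_restriction[OF c(3) U]])
    moreover have "(\<theta> \<inter> (\<phi> O \<psi>)) \<inter> U \<times> U = T \<inter> (P O S)"
      using comp_restriction[OF c(2,3) U] unfolding TPS by blast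
    moreover have "(T \<inter> P) O (T \<inter> S) \<subseteq> (\<theta> \<inter> \<phi>) O (\<theta> \<inter> \<psi>)"
      unfolding TPS by blast
    ultimately show "(\<theta> \<inter> (\<phi> O \<psi>)) \<inter> U \<times> U \<subseteq> (\<theta> \<inter> \<phi>) O (\<theta> \<inter> \<psi>)" by simp
  qed
qed

lemma arithmetical: "arithmetical A"
  by (intro arithmeticalI ballI equalityI permute_Con distrib_Con)

end

lemma compatible_projection:
  assumes r: "r \<in> Inv A m" and ij: "i < m" "j < m"
  shows "compatible A ((\<lambda>y. (y ! i, y ! j)) ` r)"
  unfolding compatible_iff
proof (intro conjI allI ballI impI)
  have "r \<subseteq> nlists m (carrier A)" using r by (simp add: Inv_def)
  then show "(\<lambda>y. (y ! i, y ! j)) ` r \<subseteq> carrier A \<times> carrier A"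
    using ij nlistsE_nth_in by blast
  fix n f xs ys
  assume f: "f \<in> Clo A n" "length xs = n" "(xs, ys) \<in> listrel ((\<lambda>y. (y ! i, y ! j)) ` r)"
  then have len: "length ys = n" by (simp add: listrel_iff_nth)
  have "\<forall>k. \<exists>y. k < n \<longrightarrow> y \<in> r \<and> y ! i = xs ! k \<and> y ! j = ys ! k"
  proof (intro allI)
    fix k show "\<exists>y. k < n \<longrightarrow> y \<in> r \<and> y ! i = xs ! k \<and> y ! j = ys ! k"
    proof (cases "k < n")
      case True
      then have "(xs ! k, ys ! k) \<in> (\<lambda>y. (y ! i, y ! j)) ` r"
        using f(2,3) by (simp add: listrel_iff_nth)
      then show ?thesis by force
    qed simp
  qed
  then obtain t where t: "\<And>k. k < n \<Longrightarrow> t k \<in> r \<and> t k ! i = xs ! k \<and> t k ! j = ys ! k" by metis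
  have "coordinatewise m f (map t [0..<n]) \<in> r"
    using t by (intro Inv_closed[OF r f(1)]) (auto simp: nlists_iff)
  moreover have "map (\<lambda>y. y ! i) (map t [0..<n]) = xs" "map (\<lambda>y. y ! j) (map t [0..<n]) = ys"
    using t f(2) len by (auto intro!: nth_equalityI)
  then have "coordinatewise m f (map t [0..<n]) ! i = f xs" "coordinatewise m f (map t [0..<n]) ! j = f ys"
    using ij by simp_all
  ultimately show "(f xs, f ys) \<in> (\<lambda>y. (y ! i, y ! j)) ` r" by force
qed

text \<open>
  The value tables of the \<open>n\<close>-ary members of the clone form the subpower generated by the projections.
\<close>

lemma Clo_tuples_Inv:
  assumes alg: "is_algebra A" and cs: "set cs \<subseteq> nlists n (carrier A)"
  shows "(\<lambda>g. map g cs) ` Clo A n \<in> Inv A (length cs)"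
  unfolding Inv_def mem_Collect_eq preserves_def
proof (intro conjI allI ballI)
  show "(\<lambda>g. map g cs) ` Clo A n \<subseteq> nlists (length cs) (carrier A)"
    using Clo_closed[OF alg] cs by (auto simp: nlists_iff subset_iff)
  fix k h ts assume h: "h \<in> Clo A k" and ts: "ts \<in> nlists k ((\<lambda>g. map g cs) ` Clo A n)"
  then have "set ts \<subseteq> (\<lambda>g. map g cs) ` Clo A n" by (simp add: nlists_iff)
  then have "ts \<in> map (\<lambda>g. map g cs) ` lists (Clo A n)" by (simp add: lists_image in_lists_conv_set subset_iff flip: lists_image)
  then obtain gs where gs: "set gs \<subseteq> Clo A n" "ts = map (\<lambda>g. map g cs) gs" by auto
  have "gs \<in> nlists k (Clo A n)" using gs ts by (simp add: nlists_iff)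
  then have "composition (carrier A) n h gs \<in> Clo A n"
    using alg h by (auto simp: is_algebra_def clone_on_def)
  moreover have "coordinatewise (length cs) h ts = map (composition (carrier A) n h gs) cs"
  proof (rule nth_equalityI)
    fix i assume "i < length (coordinatewise (length cs) h ts)"
    then have i: "i < length cs" by simp
    then have "cs ! i \<in> nlists n (carrier A)" using cs nth_mem by blast
    then show "coordinatewise (length cs) h ts ! i = map (composition (carrier A) n h gs) cs ! i"
      using i by (simp add: gs(2) composition_def comp_def)
  qed simp
  ultimately show "coordinatewise (length cs) h ts \<in> (\<lambda>g. map g cs) ` Clo A n"
    by (intro image_eqI[where x = "composition (carrier A) n h gs"])
qed

context primal_cover
begin

text \<open>
  The tuples whose pairs of coordinates lie in the binary projections of \<open>r\<close> form an invariant
  relation containing \<open>r\<close>. On a primal neighbourhood both relations are given by the same equalities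
  between coordinates, so they agree there, and hence everywhere.
\<close>

lemma Inv_determined_by_pairs:
  assumes r: "r \<in> Inv A m" and x: "x \<in> nlists m (carrier A)"
    and pairs: "\<And>i j. i < m \<Longrightarrow> j < m \<Longrightarrow> \<exists>y\<in>r. y ! i = x ! i \<and> y ! j = x ! j"
  shows "x \<in> r"
proof -
  define proj where "proj i j = (\<lambda>y. (y ! i, y ! j)) ` r" for i j
  define s where "s = {z \<in> nlists m (carrier A). \<forall>i<m. \<forall>j<m. (z ! i, z ! j) \<in> proj i j}"
  have s: "s \<in> Inv A m"
    unfolding Inv_def mem_Collect_eq preserves_def
  proof (intro conjI allI ballI)
    show "s \<subseteq> nlists m (carrier A)" unfolding s_def by blast
    fix n f ts assume f: "f \<in> Clo A n" and ts: "ts \<in> nlists n s"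
    have pair: "(f (map (\<lambda>t. t ! i) ts), f (map (\<lambda>t. t ! j) ts)) \<in> proj i j" if "i < m" "j < m" for i j
    proof -
      have "(map (\<lambda>t. t ! i) ts, map (\<lambda>t. t ! j) ts) \<in> listrel (proj i j)"
        using ts that nlistsE_nth_in[OF ts] by (auto simp: listrel_iff_nth nlists_iff s_def)
      then show ?thesis
        using compatible_projection[OF r that] f ts
        unfolding compatible_iff proj_def[symmetric] by (simp add: nlists_iff)
    qed
    have "f (map (\<lambda>t. t ! i) ts) \<in> carrier A" if "i < m" for i
      using pair[OF that that] compatible_projection[OF r that that]
      unfolding compatible_iff proj_def[symmetric] by blast
    then have "coordinatewise m f ts \<in> nlists m (carrier A)"
      by (auto simp: nlists_iff coordinatewise_def)
    then show "coordinatewise m f ts \<in> s" using pair by (simp add: s_def)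
  qed
  have "s \<subseteq> r"
  proof (rule cover_subset[OF cov s r])
    fix U assume U: "U \<in> \<U>"
    obtain e where e: "e \<in> Clo A 1" "\<And>x. x \<in> carrier A \<Longrightarrow> e [x] \<in> U" "\<And>u. u \<in> U \<Longrightarrow> e [u] = u"
      using neighbourhood_retraction[OF nbhd[OF U]] by blast
    show "s \<inter> nlists m U \<subseteq> r"
    proof
      fix z assume z: "z \<in> s \<inter> nlists m U"
      show "z \<in> r"
      proof (rule primal_neighbourhood_interpolation[OF fin alg nbhd[OF U] member_nonempty[OF U]
            prim[OF U] r])
        show "z \<in> nlists m U" using z by simp
        fix i j assume ij: "i < m" "j < m" and eq: "\<forall>y\<in>r \<inter> nlists m U. y ! i = y ! j"
        have "(z ! i, z ! j) \<in> proj i j" using z ij by (simp add: s_def)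
        then obtain y where y: "y \<in> r" "y ! i = z ! i" "y ! j = z ! j" by (auto simp: proj_def)
        have "z ! i \<in> U" "z ! j \<in> U" using z ij nlistsE_nth_in by auto
        then have y': "coordinatewise m e [y] ! i = z ! i" "coordinatewise m e [y] ! j = z ! j"
          using ij y(2,3) e(3) by simp_all
        have "y \<in> nlists m (carrier A)" using y(1) r by (auto simp: Inv_def)
        then have "coordinatewise m e [y] \<in> nlists m U"
          using e(2) nlistsE_nth_in by (fastforce simp: nlists_iff coordinatewise_def)
        moreover have "coordinatewise m e [y] \<in> r"
          using y(1) by (intro Inv_closed[OF r e(1)]) (simp add: nlists_iff)
        ultimately have "coordinatewise m e [y] ! i = coordinatewise m e [y] ! j"
          by (intro bspec[OF eq] IntI)
        then show "z ! i = z ! j" by (simp only: y')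
      qed
    qed
  qed
  moreover have "(x ! i, x ! j) \<in> proj i j" if ij: "i < m" "j < m" for i j
  proof -
    obtain y where y: "y \<in> r" "y ! i = x ! i" "y ! j = x ! j" using pairs[OF ij] by blast
    have "(y ! i, y ! j) \<in> proj i j" using y(1) by (simp add: proj_def)
    then show ?thesis by (simp only: y)
  qed
  then have "x \<in> s" using x by (simp add: s_def)
  ultimately show ?thesis by blast
qed

text \<open>
  The value table of \<open>f\<close> satisfies every binary projection of the relation of value tables of the
  clone: such a projection is a congruence that relates the two arguments, because the
  coordinate projections belong to the clone.
\<close>

lemma congruence_primal: "congruence_primal A"
  unfolding congruence_primal_def
proof (intro conjI fin allI ballI impI)
  fix n f
  assume f: "f \<in> ops (carrier A) n" and pres: "\<forall>\<theta>\<in>Con A. preserves n f 2 (pair_relation \<theta>)"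
  obtain cs where cs: "set cs = nlists n (carrier A)"
    using finite_list[OF finite_nlists[OF fin]] by blast
  let ?r = "(\<lambda>g. map g cs) ` Clo A n"
  have r: "?r \<in> Inv A (length cs)" using Clo_tuples_Inv[OF alg] cs by blast
  have "map f cs \<in> ?r"
  proof (rule Inv_determined_by_pairs[OF r])
    show "map f cs \<in> nlists (length cs) (carrier A)"
      using f cs by (auto simp: ops_def nlists_iff)
    fix i j assume ij: "i < length cs" "j < length cs"
    let ?\<theta> = "(\<lambda>y. (y ! i, y ! j)) ` ?r"
    have "?\<theta> \<in> Con A" using compatible_Con[OF compatible_projection[OF r ij]] .
    moreover have c: "cs ! i \<in> nlists n (carrier A)" "cs ! j \<in> nlists n (carrier A)"
      using cs ij nth_mem by blast+
    moreover have "(cs ! i, cs ! j) \<in> listrel ?\<theta>"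
    proof -
      have "(cs ! i ! k, cs ! j ! k) \<in> ?\<theta>" if "k < n" for k
      proof -
        have "projection (carrier A) n k \<in> Clo A n"
          using alg that by (simp add: is_algebra_def clone_on_def)
        then have "map (projection (carrier A) n k) cs \<in> ?r" by (rule imageI)
        then have "(\<lambda>y. (y ! i, y ! j)) (map (projection (carrier A) n k) cs) \<in> ?\<theta>" by (rule imageI)
        then show ?thesis using ij c by (simp add: projection_def)
      qed
      then show ?thesis using c unfolding nlists_iff listrel_iff_nth by simp
    qed
    ultimately have "(f (cs ! i), f (cs ! j)) \<in> ?\<theta>"
      using pres unfolding preserves_pair_relation by (simp add: nlists_iff)
    then obtain y where "y \<in> ?r" "f (cs ! i) = y ! i" "f (cs ! j) = y ! j" by blast
    then show "\<exists>y\<in>?r. y ! i = map f cs ! i \<and> y ! j = map f cs ! j"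
      using ij by (intro bexI[of _ y]) simp_all
  qed
  then obtain g where g: "g \<in> Clo A n" "map f cs = map g cs" by blast
  have "g \<in> ops (carrier A) n" using alg g by (auto simp: is_algebra_def clone_on_def)
  then have "f = g"
    using f g(2) cs unfolding ops_def by (intro PiE_ext) auto
  then show "f \<in> Clo A n" using g by simp
qed

end

section \<open>Two-element neighbourhoods from splitting pairs\<close>

locale congruence_primal_arithmetical =
  fixes A :: "'a clone_algebra"
  assumes alg: "is_algebra A" and fin: "finite (carrier A)" and nonempty: "carrier A \<noteq> {}"
    and cp: "congruence_primal A" and ar: "arithmetical A"
begin

sublocale arithmetical_equivalences "carrier A" "Con A"
  by (rule arithmetical_equivalences_Con[OF alg fin ar])

lemma compatible_on_imp_Clo:
  assumes "f \<in> ops (carrier A) n" "compatible_on (nlists n (carrier A)) f"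
  shows "f \<in> Clo A n"
proof -
  have "preserves n f 2 (pair_relation \<theta>)" if \<theta>: "\<theta> \<in> Con A" for \<theta>
    unfolding preserves_pair_relation
  proof (intro allI impI)
    fix xs ys assume xy: "length xs = n" "(xs, ys) \<in> listrel \<theta>"
    have "xs ! i \<in> carrier A \<and> ys ! i \<in> carrier A" if "i < n" for i
      using xy that in_base[OF \<theta>] by (auto simp: listrel_iff_nth)
    then have "xs \<in> nlists n (carrier A)" "ys \<in> nlists n (carrier A)"
      using xy by (auto simp: nlists_iff listrel_iff_nth set_conv_nth)
    then show "(f xs, f ys) \<in> \<theta>" using assms(2) \<theta> xy(2) by (simp add: compatible_on_def)
  qed
  then show ?thesis using cp assms(1) by (simp add: congruence_primal_def)
qed

text \<open>
  A congruence above \<open>\<alpha>\<close> relates all values of \<open>f\<close>; any other congruence is below \<open>\<beta>\<close>, so that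
  related arguments have equal values.
\<close>

lemma two_valued_Clo:
  assumes sp: "splitting \<alpha> \<beta>" and ab: "(a, b) \<in> \<alpha>"
    and f: "f \<in> extensional (nlists n (carrier A))"
    and val: "\<And>xs. xs \<in> nlists n (carrier A) \<Longrightarrow> f xs \<in> {a, b}"
    and inv: "\<And>xs ys. xs \<in> nlists n (carrier A) \<Longrightarrow> ys \<in> nlists n (carrier A) \<Longrightarrow>
      (xs, ys) \<in> listrel \<beta> \<Longrightarrow> f xs = f ys"
  shows "f \<in> Clo A n"
proof (rule compatible_on_imp_Clo)
  have \<alpha>\<beta>: "\<alpha> \<in> Con A" "\<beta> \<in> Con A" and split: "\<And>\<theta>. \<theta> \<in> Con A \<Longrightarrow> \<alpha> \<subseteq> \<theta> \<or> \<theta> \<subseteq> \<beta>"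
    using sp by (auto simp: splitting_def)
  have abX: "a \<in> carrier A" "b \<in> carrier A" using in_base[OF \<alpha>\<beta>(1) ab] by auto
  show "f \<in> ops (carrier A) n"
    unfolding ops_def using f val abX by (intro PiE_I) (force simp: extensional_def)+
  show "compatible_on (nlists n (carrier A)) f"
    unfolding compatible_on_def
  proof (intro ballI impI)
    fix \<theta> xs ys assume \<theta>: "\<theta> \<in> Con A"
      and xy: "xs \<in> nlists n (carrier A)" "ys \<in> nlists n (carrier A)" "(xs, ys) \<in> listrel \<theta>"
    show "(f xs, f ys) \<in> \<theta>"
    proof (cases "\<alpha> \<subseteq> \<theta>")
      case True
      then have "(a, b) \<in> \<theta>" "(b, a) \<in> \<theta>" "(a, a) \<in> \<theta>" "(b, b) \<in> \<theta>"
        using ab symmetric[OF \<theta>] reflexive[OF \<theta>] abX by blast+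
      then show ?thesis using val[OF xy(1)] val[OF xy(2)] by auto
    next
      case False
      then have "(xs, ys) \<in> listrel \<beta>" using split[OF \<theta>] xy(3) listrel_mono by blast
      then have "f xs = f ys" by (rule inv[OF xy(1,2)])
      moreover have "f ys \<in> carrier A" using val[OF xy(2)] abX by auto
      ultimately show ?thesis using reflexive[OF \<theta>] by simp
    qed
  qed
qed

lemma Id_on_Con: "Id_on (carrier A) \<in> Con A"
  using compatible_Id_on[OF alg]
  by (auto simp: Con_iff equiv_def refl_on_def sym_def trans_def)

text \<open>
  The general unary operation obtained from \<open>two_valued_Clo\<close>. The class of \<open>b\<close> with values \<open>a\<close>, \<open>b\<close>
  gives the retraction onto \<open>{a, b}\<close>; other classes are used to separate points.
\<close>

definition class_test :: "('a \<times> 'a) set \<Rightarrow> 'a \<Rightarrow> 'a \<Rightarrow> 'a \<Rightarrow> 'a \<Rightarrow> 'a" where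
  "class_test \<beta> p c d x = (if (x, p) \<in> \<beta> then d else c)"

lemma class_test_cong:
  assumes "\<beta> \<in> Con A" "(x, y) \<in> \<beta>"
  shows "class_test \<beta> p c d x = class_test \<beta> p c d y"
  unfolding class_test_def
  using transitive[OF assms(1), of x y p] transitive[OF assms(1), of y x p]
    symmetric[OF assms] assms(2) by auto

lemma class_test_Clo:
  assumes "splitting \<alpha> \<beta>" "(c, d) \<in> \<alpha>"
  shows "restrict (\<lambda>xs. class_test \<beta> p c d (hd xs)) (nlists 1 (carrier A)) \<in> Clo A 1"
    (is "?e \<in> _")
proof (rule two_valued_Clo[OF assms])
  have \<beta>: "\<beta> \<in> Con A" using assms(1) by (simp add: splitting_def)
  fix xs ys :: "'a list"
  assume xy: "xs \<in> nlists 1 (carrier A)" "ys \<in> nlists 1 (carrier A)" "(xs, ys) \<in> listrel \<beta>"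
  then obtain x y where "xs = [x]" "ys = [y]" by (auto simp: nlists_iff length_Suc_conv)
  then show "?e xs = ?e ys"
    using class_test_cong[OF \<beta>, of x y] xy by (simp add: listrel_iff_nth)
qed (auto simp: class_test_def)

lemma splitting_neighbourhood:
  assumes sp: "splitting \<alpha> \<beta>" and ab: "(a, b) \<in> \<alpha>" "(a, b) \<notin> \<beta>"
  shows "neighbourhood A {a, b}"
proof -
  have \<alpha>\<beta>: "\<alpha> \<in> Con A" "\<beta> \<in> Con A" using sp by (auto simp: splitting_def)
  have abX: "a \<in> carrier A" "b \<in> carrier A" using in_base[OF \<alpha>\<beta>(1) ab(1)] by auto
  define e where "e = restrict (\<lambda>xs. class_test \<beta> b a b (hd xs)) (nlists 1 (carrier A))"
  have e: "e [x] = (if (x, b) \<in> \<beta> then b else a)" if "x \<in> carrier A" for x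
    using that by (simp add: e_def nlists_iff class_test_def)
  have "e [a] = a" "e [b] = b" using e abX ab(2) reflexive[OF \<alpha>\<beta>(2)] by auto
  moreover have "e [x] \<in> {a, b}" if "x \<in> carrier A" for x using e[OF that] by simp
  ultimately have "(\<lambda>x. e [x]) ` carrier A = {a, b}" "\<forall>x\<in>carrier A. e [e [x]] = e [x]"
    using abX by force+
  moreover have "e \<in> Clo A 1" unfolding e_def by (rule class_test_Clo[OF sp ab(1)])
  ultimately show ?thesis unfolding neighbourhood_def by (intro bexI[of _ e] conjI) (simp_all only:)
qed

text \<open>
  An operation on \<open>{a, b}\<close> is extended to the algebra by first retracting all arguments.
\<close>

lemma splitting_primal:
  assumes sp: "splitting \<alpha> \<beta>" and ab: "(a, b) \<in> \<alpha>" "(a, b) \<notin> \<beta>"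
  shows "primal (induced_algebra A {a, b})"
proof -
  have \<alpha>\<beta>: "\<alpha> \<in> Con A" "\<beta> \<in> Con A" using sp by (auto simp: splitting_def)
  have abX: "a \<in> carrier A" "b \<in> carrier A" using in_base[OF \<alpha>\<beta>(1) ab(1)] by auto
  let ?U = "{a, b}"
  have "Clo (induced_algebra A ?U) n = ops ?U n" for n
  proof (intro equalityI subsetI)
    fix g assume "g \<in> Clo (induced_algebra A ?U) n"
    then show "g \<in> ops ?U n" by (auto simp: induced_algebra_def ops_def)
  next
    fix g assume g: "g \<in> ops ?U n"
    define t where "t = restrict (\<lambda>xs. g (map (class_test \<beta> b a b) xs)) (nlists n (carrier A))"
    have val: "t xs \<in> ?U" if "xs \<in> nlists n (carrier A)" for xs
    proof -
      have "map (class_test \<beta> b a b) xs \<in> nlists n ?U" using that by (auto simp: nlists_iff class_test_def)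
      then show ?thesis using g that unfolding ops_def t_def by (simp add: PiE_iff del: insert_iff)
    qed
    have "t \<in> Clo A n"
    proof (rule two_valued_Clo[OF sp ab(1) _ val])
      fix xs ys assume xy: "xs \<in> nlists n (carrier A)" "ys \<in> nlists n (carrier A)" "(xs, ys) \<in> listrel \<beta>"
      have "map (class_test \<beta> b a b) xs = map (class_test \<beta> b a b) ys"
        using xy(3) class_test_cong[OF \<alpha>\<beta>(2)] by (auto simp: listrel_iff_nth intro!: nth_equalityI)
      then show "t xs = t ys" using xy by (simp add: t_def)
    qed (simp add: t_def extensional_def)
    moreover have U_X: "nlists n ?U \<subseteq> nlists n (carrier A)" using abX by (intro nlists_mono) simp
    moreover have "g = restrict t (nlists n ?U)"
    proof
      fix xs
      show "g xs = restrict t (nlists n ?U) xs"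
      proof (cases "xs \<in> nlists n ?U")
        case True
        have "class_test \<beta> b a b x = x" if "x \<in> ?U" for x
          using that ab(2) reflexive[OF \<alpha>\<beta>(2) abX(2)] by (auto simp: class_test_def)
        then have "map (class_test \<beta> b a b) xs = xs"
          using True by (intro map_idI) (auto simp: nlists_iff)
        then show ?thesis using True U_X by (auto simp: t_def)
      next
        case False
        then show ?thesis using g by (auto simp: ops_def)
      qed
    qed
    moreover have "t ` nlists n ?U \<subseteq> ?U" using val U_X by blast
    ultimately have "\<exists>t. g = restrict t (nlists n ?U) \<and> t \<in> Clo A n \<and> t ` nlists n ?U \<subseteq> ?U"
      by (intro exI[of _ t] conjI)
    then show "g \<in> Clo (induced_algebra A ?U) n"
      unfolding induced_algebra_def by (simp only: select_convs mem_Collect_eq)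
  qed
  then show ?thesis by (simp add: primal_def induced_algebra_def)
qed

text \<open>
  The congruence \<open>\<alpha>\<close> is principal, generated by any of its pairs outside \<open>\<beta>\<close>.
\<close>

lemma splitting_generated:
  assumes "splitting \<alpha> \<beta>" "(a, b) \<in> \<alpha>" "(a, b) \<notin> \<beta>" "\<theta> \<in> Con A"
  shows "(a, b) \<in> \<theta> \<longleftrightarrow> \<alpha> \<subseteq> \<theta>"
  using assms by (auto simp: splitting_def)

text \<open>
  Let \<open>x \<in> r\<close>. To obtain \<open>x \<in> s\<close> it suffices to interpolate: an operation must send the columns of the
  list of all tuples of \<open>s\<close> to the entries of \<open>x\<close>. This prescription is compatible, because if
  \<open>\<theta>\<close> does not relate two entries of \<open>x\<close>, then a \<open>class_test\<close> with values in some member \<open>{a, b}\<close> of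
  the cover separates them modulo \<open>\<theta>\<close>; applied to \<open>x\<close> it gives a tuple of \<open>r\<close> over \<open>{a, b}\<close>, which
  is one of the tuples of \<open>s\<close>.
\<close>

lemma separating_cover:
  assumes nb: "\<And>U. U \<in> \<U> \<Longrightarrow> neighbourhood A U"
    and rep: "\<And>\<alpha> \<beta>. splitting \<alpha> \<beta> \<Longrightarrow>
      \<exists>a b. (a, b) \<in> \<alpha> \<and> (\<forall>\<theta>\<in>Con A. (a, b) \<in> \<theta> \<longrightarrow> \<alpha> \<subseteq> \<theta>) \<and> {a, b} \<in> \<U>"
  shows "cover A \<U>"
proof -
  have sub: "r \<subseteq> s" if r: "r \<in> Inv A m" and s: "s \<in> Inv A m"
    and eq: "\<And>U. U \<in> \<U> \<Longrightarrow> r \<inter> nlists m U \<subseteq> s" for r s m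
  proof
    fix x assume x: "x \<in> r"
    then have xX: "x \<in> nlists m (carrier A)" using r by (auto simp: Inv_def)
    have xc: "x ! j \<in> carrier A" if "j < m" for j using nlistsE_nth_in[OF xX that] .
    have sX: "s \<subseteq> nlists m (carrier A)" using s by (simp add: Inv_def)
    have "finite s" using finite_nlists[OF fin] sX finite_subset by blast
    then obtain ys where ys: "set ys = s" using finite_list by blast
    define column where "column j = map (\<lambda>y. y ! j) ys" for j
    define n where "n = length ys"
    have sep: "(x ! i, x ! j) \<in> \<theta>"
      if \<theta>: "\<theta> \<in> Con A" and ij: "i < m" "j < m" and rel: "(column i, column j) \<in> listrel \<theta>" for \<theta> i j
    proof (rule ccontr)
      assume not: "(x ! i, x ! j) \<notin> \<theta>"
      \<comment> \<open>the congruence generated by \<open>(x ! i, x ! j)\<close>\<close>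
      let ?\<phi> = "\<Inter>{\<phi> \<in> Con A. (x ! i, x ! j) \<in> \<phi>}"
      have "?\<phi> \<in> Con A" using top_mem xc ij by (intro Inter_mem) auto
      moreover have "\<not> ?\<phi> \<subseteq> \<theta>" using not by blast
      ultimately obtain \<alpha> \<beta> where sp: "splitting \<alpha> \<beta>" "\<alpha> \<subseteq> ?\<phi>" "\<not> \<alpha> \<subseteq> \<theta>"
        using exists_splitting[OF _ \<theta>] by blast
      have \<beta>: "\<beta> \<in> Con A" "\<not> \<alpha> \<subseteq> \<beta>" using sp(1) by (simp_all add: splitting_def)
      have not\<beta>: "(x ! i, x ! j) \<notin> \<beta>" using sp(2) \<beta> by blast
      obtain a b where ab: "(a, b) \<in> \<alpha>" "\<And>\<theta>. \<theta> \<in> Con A \<Longrightarrow> (a, b) \<in> \<theta> \<Longrightarrow> \<alpha> \<subseteq> \<theta>" "{a, b} \<in> \<U>"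
        using rep[OF sp(1)] by blast
      define e where "e = restrict (\<lambda>xs. class_test \<beta> (x ! j) a b (hd xs)) (nlists 1 (carrier A))"
      have e: "e [z] = (if (z, x ! j) \<in> \<beta> then b else a)" if "z \<in> carrier A" for z
        using that by (simp add: e_def nlists_iff class_test_def)
      have eC: "e \<in> Clo A 1" unfolding e_def by (rule class_test_Clo[OF sp(1) ab(1)])
      let ?y = "coordinatewise m e [x]"
      have "?y \<in> r" using x by (intro Inv_closed[OF r eC]) (simp add: nlists_iff)
      moreover have "?y \<in> nlists m {a, b}"
        using e xc by (auto simp: nlists_iff coordinatewise_def)
      ultimately have "?y \<in> s" using eq[OF ab(3)] by blast
      then obtain k where k: "k < n" "ys ! k = ?y" using ys by (auto simp: in_set_conv_nth n_def)
      have "(?y ! i, ?y ! j) \<in> \<theta>"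
        using rel k by (auto simp: listrel_iff_nth column_def n_def)
      moreover have "?y ! i = a" "?y ! j = b"
        using ij e xc not\<beta> reflexive[OF \<beta>(1)] by simp_all
      ultimately show False using ab(2)[OF \<theta>] sp(3) by simp
    qed
    \<comment> \<open>Equal columns may have several indices; \<open>sep\<close> for the equality relation shows that the choice of
      an index does not affect the value.\<close>
    define D where "D = column ` {..<m}"
    define f where "f c = x ! (SOME j. j < m \<and> c = column j)" for c
    have f: "\<exists>j<m. column i = column j \<and> f (column i) = x ! j" if "i < m" for i
    proof -
      have "(SOME j. j < m \<and> column i = column j) < m \<and> column i = column (SOME j. j < m \<and> column i = column j)"
        using someI[of "\<lambda>j. j < m \<and> column i = column j" i] that by simp
      then show ?thesis unfolding f_def by blast
    qed
    have col: "column j \<in> nlists n (carrier A)" if "j < m" for j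
    proof -
      have "y ! j \<in> carrier A" if "y \<in> set ys" for y
        using that ys sX \<open>j < m\<close> nlistsE_nth_in[of y m "carrier A" j] by blast
      then show ?thesis by (auto simp: column_def n_def nlists_iff)
    qed
    have "\<exists>g. g ` nlists n (carrier A) \<subseteq> carrier A \<and> compatible_on (nlists n (carrier A)) g \<and>
        (\<forall>c\<in>D. g c = f c)"
    proof (rule extend_compatible[OF nonempty])
      show "D \<subseteq> nlists n (carrier A)" using col by (auto simp: D_def)
      have "f (column i) \<in> carrier A" if "i < m" for i using f[OF that] xc by auto
      then show "f ` D \<subseteq> carrier A" unfolding D_def by blast
      show "compatible_on D f"
        unfolding compatible_on_def
      proof (intro ballI impI)
        fix \<theta> c d assume \<theta>: "\<theta> \<in> Con A" and cd: "c \<in> D" "d \<in> D" "(c, d) \<in> listrel \<theta>"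
        then obtain i j where ij: "i < m" "j < m" "c = column i" "d = column j" unfolding D_def by blast
        obtain i' j' where ij': "i' < m" "column i = column i'" "f c = x ! i'"
          "j' < m" "column j = column j'" "f d = x ! j'"
          using f[OF ij(1)] f[OF ij(2)] ij(3,4) by blast
        then show "(f c, f d) \<in> \<theta>" using sep[OF \<theta> ij'(1,4)] cd(3) ij by simp
      qed
    qed
    then obtain g where g: "g ` nlists n (carrier A) \<subseteq> carrier A"
      "compatible_on (nlists n (carrier A)) g" "\<And>c. c \<in> D \<Longrightarrow> g c = f c" by blast
    have x_col: "g (column j) = x ! j" if j: "j < m" for j
    proof -
      obtain i where i: "i < m" "column j = column i" "f (column j) = x ! i" using f[OF j] by blast
      have "(column j, column i) \<in> listrel (Id_on (carrier A))"
        using i(2) col[OF j] by (auto simp: listrel_iff_nth nlists_iff)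
      then have "x ! j = x ! i" using sep[OF Id_on_Con j i(1)] by auto
      moreover have "column j \<in> D" using j by (simp add: D_def)
      ultimately show ?thesis using g(3) i(3) by simp
    qed
    let ?t = "restrict g (nlists n (carrier A))"
    have "?t \<in> Clo A n"
    proof (rule compatible_on_imp_Clo)
      show "?t \<in> ops (carrier A) n" using g(1) by (auto simp: ops_def)
      show "compatible_on (nlists n (carrier A)) ?t" using g(2) by (simp add: compatible_on_def)
    qed
    then have "coordinatewise m ?t ys \<in> s"
      using ys by (intro Inv_closed[OF s]) (auto simp: nlists_iff n_def)
    moreover have "coordinatewise m ?t ys = x"
    proof (rule nth_equalityI)
      fix j assume "j < length (coordinatewise m ?t ys)"
      then have j: "j < m" by simp
      then show "coordinatewise m ?t ys ! j = x ! j"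
        using x_col[OF j] col[OF j] by (simp add: column_def)
    qed (use xX in \<open>simp add: nlists_iff\<close>)
    ultimately show "x \<in> s" by simp
  qed
  show ?thesis
    unfolding cover_def
  proof (intro conjI ballI allI impI nb)
    fix m r s
    assume rs: "r \<in> Inv A m" "s \<in> Inv A m"
      and eq: "\<forall>U\<in>\<U>. r \<inter> nlists m U = s \<inter> nlists m U"
    have "r \<inter> nlists m U \<subseteq> s" "s \<inter> nlists m U \<subseteq> r" if "U \<in> \<U>" for U
      using eq[rule_format, OF that] by (metis Int_lower1)+
    then show "r = s" by (intro equalityI sub[OF rs] sub[OF rs(2,1)])
  qed
qed

end

section \<open>Irredundance and non-refinability\<close>

lemma two_element_cases: "V \<subseteq> {a, b} \<Longrightarrow> V = {a, b} \<or> (\<exists>v. V \<subseteq> {v})"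
  by (cases "a \<in> V"; cases "b \<in> V") auto

context congruence_primal_arithmetical
begin

text \<open>
  On a set with at most one element, and on \<open>{c, d}\<close> for a join prime \<open>\<gamma> \<noteq> \<alpha>\<close> generated by
  \<open>(c, d)\<close>, the congruence \<open>\<alpha>\<close> is contained in \<open>\<beta>\<close>: if \<open>\<gamma>\<close> is below \<open>\<alpha>\<close>, then \<open>\<alpha>\<close> is not below
  \<open>\<gamma>\<close>, and so \<open>\<gamma>\<close> is below \<open>\<beta>\<close>. A cover would detect that the inclusion fails.
\<close>

lemma not_cover:
  assumes sp: "splitting \<alpha> \<beta>"
    and small: "\<And>V. V \<in> \<V> \<Longrightarrow> (\<exists>v. V \<subseteq> {v}) \<or>
      (\<exists>\<gamma> \<delta> c d. splitting \<gamma> \<delta> \<and> (c, d) \<in> \<gamma> \<and> (c, d) \<notin> \<delta> \<and> \<gamma> \<noteq> \<alpha> \<and> V = {c, d})"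
  shows "\<not> cover A \<V>"
proof
  have \<alpha>\<beta>: "\<alpha> \<in> Con A" "\<beta> \<in> Con A" "\<not> \<alpha> \<subseteq> \<beta>" using sp by (auto simp: splitting_def)
  assume cov: "cover A \<V>"
  have "\<alpha> \<subseteq> \<beta>"
  proof (rule cover_compatible_subset[OF cov])
    show "compatible A \<alpha>" "compatible A \<beta>" using \<alpha>\<beta> by (simp_all add: Con_iff)
    fix V assume "V \<in> \<V>"
    have diag: "(x, x) \<in> \<beta>" if "(x, x) \<in> \<alpha>" for x
      using in_base[OF \<alpha>\<beta>(1) that] reflexive[OF \<alpha>\<beta>(2)] by blast
    from small[OF \<open>V \<in> \<V>\<close>] show "\<alpha> \<inter> V \<times> V \<subseteq> \<beta>"
    proof (elim disjE exE conjE)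
      fix v assume "V \<subseteq> {v}"
      then show ?thesis using diag by auto
    next
      fix \<gamma> \<delta> c d
      assume g: "splitting \<gamma> \<delta>" "(c, d) \<in> \<gamma>" "(c, d) \<notin> \<delta>" "\<gamma> \<noteq> \<alpha>" and V: "V = {c, d}"
      have \<gamma>: "\<gamma> \<in> Con A" using g(1) by (simp add: splitting_def)
      have cd: "(c, d) \<in> \<beta>" if "(c, d) \<in> \<alpha>"
      proof -
        have "\<gamma> \<subseteq> \<alpha>" using splitting_generated[OF g(1-3) \<alpha>\<beta>(1)] that by simp
        then have "\<not> \<alpha> \<subseteq> \<gamma>" using g(4) by blast
        then have "\<gamma> \<subseteq> \<beta>" using sp \<gamma> by (auto simp: splitting_def)
        then show ?thesis using g(2) by blast
      qed
      moreover have "(d, c) \<in> \<beta>" if "(d, c) \<in> \<alpha>"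
        using symmetric[OF \<alpha>\<beta>(1) that] cd symmetric[OF \<alpha>\<beta>(2)] by blast
      ultimately show ?thesis using diag V by auto
    qed
  qed
  then show False using \<alpha>\<beta>(3) by simp
qed

text \<open>
  A cover obtained by omitting \<open>{a \<alpha>, b \<alpha>}\<close>, and equally a refinement in which no member contains
  \<open>{a \<alpha>, b \<alpha>}\<close>, consists of sets to which \<open>not_cover\<close> applies.
\<close>

lemma primal_irredundant_non_refinable_cover:
  obtains \<U> where "irredundant_cover A \<U>" "non_refinable_cover A \<U>"
    and "\<And>U. U \<in> \<U> \<Longrightarrow> primal (induced_algebra A U)"
proof -
  define J where "J = {\<alpha>. \<exists>\<beta>. splitting \<alpha> \<beta>}"
  have "\<forall>\<alpha>\<in>J. \<exists>t. case t of (\<beta>, a, b) \<Rightarrow> splitting \<alpha> \<beta> \<and> (a, b) \<in> \<alpha> \<and> (a, b) \<notin> \<beta>"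
  proof
    fix \<alpha> assume "\<alpha> \<in> J"
    then obtain \<beta> where \<beta>: "splitting \<alpha> \<beta>" by (auto simp: J_def)
    then obtain a b where "(a, b) \<in> \<alpha>" "(a, b) \<notin> \<beta>" by (auto simp: splitting_def)
    with \<beta> show "\<exists>t. case t of (\<beta>, a, b) \<Rightarrow> splitting \<alpha> \<beta> \<and> (a, b) \<in> \<alpha> \<and> (a, b) \<notin> \<beta>"
      by (intro exI[of _ "(\<beta>, a, b)"]) simp
  qed
  then obtain t where t: "\<forall>\<alpha>\<in>J. case t \<alpha> of (\<beta>, a, b) \<Rightarrow> splitting \<alpha> \<beta> \<and> (a, b) \<in> \<alpha> \<and> (a, b) \<notin> \<beta>"
    by (rule bchoice[THEN exE])
  define \<beta> a b where "\<beta> \<alpha> = fst (t \<alpha>)" and "a \<alpha> = fst (snd (t \<alpha>))" and "b \<alpha> = snd (snd (t \<alpha>))" for \<alpha>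
  have J: "splitting \<alpha> (\<beta> \<alpha>)" "(a \<alpha>, b \<alpha>) \<in> \<alpha>" "(a \<alpha>, b \<alpha>) \<notin> \<beta> \<alpha>" if "\<alpha> \<in> J" for \<alpha>
    using bspec[OF t that] by (auto simp: \<beta>_def a_def b_def split: prod.splits)
  define U where "U \<alpha> = {a \<alpha>, b \<alpha>}" for \<alpha>
  have cov: "cover A (U ` J)"
  proof (rule separating_cover)
    show "neighbourhood A V" if "V \<in> U ` J" for V
      using that splitting_neighbourhood[OF J] by (auto simp: U_def)
    fix \<alpha> \<beta>' assume "splitting \<alpha> \<beta>'"
    then have \<alpha>: "\<alpha> \<in> J" by (auto simp: J_def)
    then show "\<exists>a b. (a, b) \<in> \<alpha> \<and> (\<forall>\<theta>\<in>Con A. (a, b) \<in> \<theta> \<longrightarrow> \<alpha> \<subseteq> \<theta>) \<and> {a, b} \<in> U ` J"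
      using splitting_generated[OF J] J(2)
      by (intro exI[of _ "a \<alpha>"] exI[of _ "b \<alpha>"]) (auto simp: U_def)
  qed
  have no_cover: "\<not> cover A \<V>"
    if \<alpha>: "\<alpha> \<in> J" and \<V>: "\<And>V. V \<in> \<V> \<Longrightarrow> (\<exists>v. V \<subseteq> {v}) \<or> V \<in> U ` (J - {\<alpha>})" for \<alpha> \<V>
  proof (rule not_cover[OF J(1)[OF \<alpha>]])
    fix V assume "V \<in> \<V>"
    from \<V>[OF this] show "(\<exists>v. V \<subseteq> {v}) \<or> (\<exists>\<gamma> \<delta> c d. splitting \<gamma> \<delta> \<and> (c, d) \<in> \<gamma> \<and>
        (c, d) \<notin> \<delta> \<and> \<gamma> \<noteq> \<alpha> \<and> V = {c, d})"
    proof
      assume "V \<in> U ` (J - {\<alpha>})"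
      then obtain \<gamma> where \<gamma>: "\<gamma> \<in> J" "\<gamma> \<noteq> \<alpha>" "V = {a \<gamma>, b \<gamma>}" by (auto simp: U_def)
      then show ?thesis using J[OF \<gamma>(1)] by metis
    qed simp
  qed
  have "irredundant_cover A (U ` J)"
    unfolding irredundant_cover_def
  proof (intro conjI allI impI cov)
    fix \<V> assume \<V>: "\<V> \<subset> U ` J"
    then obtain \<alpha> where "\<alpha> \<in> J" "U \<alpha> \<notin> \<V>" by blast
    moreover from this have "V \<in> U ` (J - {\<alpha>})" if "V \<in> \<V>" for V using \<V> that by auto
    ultimately show "\<not> cover A \<V>" by (intro no_cover) auto
  qed
  moreover have "non_refinable_cover A (U ` J)"
    unfolding non_refinable_cover_def proper_refinement_def
  proof (intro conjI notI cov, elim exE conjE)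
    fix \<V> assume \<V>: "cover A \<V>" "refinement \<V> (U ` J)" "\<not> refinement (U ` J) \<V>"
    then obtain \<alpha> where \<alpha>: "\<alpha> \<in> J" "\<And>V. V \<in> \<V> \<Longrightarrow> \<not> U \<alpha> \<subseteq> V" by (auto simp: refinement_def)
    have "(\<exists>v. V \<subseteq> {v}) \<or> V \<in> U ` (J - {\<alpha>})" if V: "V \<in> \<V>" for V
    proof -
      obtain \<gamma> where \<gamma>: "\<gamma> \<in> J" "V \<subseteq> U \<gamma>" using \<V>(2) V by (auto simp: refinement_def)
      have "V = U \<gamma> \<or> (\<exists>v. V \<subseteq> {v})" using two_element_cases \<gamma>(2) unfolding U_def by metis
      then show ?thesis using \<alpha>(2)[OF V] \<gamma>(1) by auto
    qed
    then show False using no_cover[OF \<alpha>(1)] \<V>(1) by blast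
  qed
  moreover have "primal (induced_algebra A V)" if "V \<in> U ` J" for V
    using that splitting_primal[OF J] by (auto simp: U_def)
  ultimately show thesis by (rule that)
qed

end

section \<open>The empty algebra\<close>

lemma ops_empty_0: "ops {} 0 = {}"
  by (simp add: ops_def)

lemma nlists_empty: "nlists n {} = (if n = 0 then {[]} else {})"
  by (auto simp: nlists_iff)

lemma Clo_empty_carrier:
  assumes alg: "is_algebra A" and empty: "carrier A = {}"
  shows "Clo A n = ops {} n"
proof
  show "Clo A n \<subseteq> ops {} n" using alg empty by (simp add: is_algebra_def clone_on_def)
  show "ops {} n \<subseteq> Clo A n"
  proof (cases n)
    case (Suc k)
    have "projection {} n 0 \<in> Clo A n"
      using alg empty Suc by (auto simp: is_algebra_def clone_on_def)
    moreover have "f = projection {} n 0" if "f \<in> ops {} n" for f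
      using that Suc by (simp add: ops_def projection_def nlists_empty restrict_def)
    ultimately show ?thesis by blast
  qed (simp add: ops_empty_0)
qed

lemma empty_carrier_congruence_primal_arithmetical:
  assumes alg: "is_algebra A" and empty: "carrier A = {}"
  shows "congruence_primal A" and "arithmetical A"
proof -
  show "congruence_primal A" by (simp add: congruence_primal_def Clo_empty_carrier[OF assms] empty)
  have "\<theta> = {}" if "\<theta> \<in> Con A" for \<theta> using that empty by (auto simp: Con_def equiv_def)
  then show "arithmetical A" by (intro arithmeticalI) blast+
qed

text \<open>
  The empty family is not a cover: without nullary operations both relations of arity \<open>0\<close> are
  invariant, and only a member of the cover can distinguish them.
\<close>

lemma empty_carrier_cover:
  assumes alg: "is_algebra A" and empty: "carrier A = {}"
  shows "irredundant_cover A {{}}" and "non_refinable_cover A {{}}"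
    and "primal (induced_algebra A {})"
proof -
  have "projection {} 1 0 \<in> Clo A 1"
    using alg empty by (auto simp: is_algebra_def clone_on_def)
  then have "neighbourhood A {}" unfolding neighbourhood_def empty by auto
  moreover have "r \<inter> nlists m {} = r" if "r \<in> Inv A m" for r m
    using that empty by (auto simp: Inv_def)
  ultimately have cov: "cover A {{}}" unfolding cover_def by auto
  have "{} \<in> Inv A 0"
  proof -
    have "n \<noteq> 0" if "f \<in> Clo A n" for n f
      using that Clo_empty_carrier[OF assms] ops_empty_0 by (cases n) auto
    then show ?thesis by (auto simp: Inv_def preserves_def nlists_empty)
  qed
  moreover have "{[]} \<in> Inv A 0" by (simp add: Inv_def preserves_def coordinatewise_def)
  ultimately have no_cov: "\<not> cover A {}" unfolding cover_def by blast
  show "irredundant_cover A {{}}"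
    using cov no_cov by (auto simp: irredundant_cover_def psubset_eq subset_singleton_iff)
  show "non_refinable_cover A {{}}"
    using cov no_cov by (auto simp: non_refinable_cover_def proper_refinement_def refinement_def)
  have "{restrict t (nlists n {}) |t. t \<in> ops {} n \<and> t ` nlists n {} \<subseteq> {}} = ops {} n" for n
    by (cases n) (auto simp: ops_def nlists_empty restrict_def)
  then have "Clo (induced_algebra A {}) n = ops {} n" for n
    unfolding induced_algebra_def Clo_empty_carrier[OF assms] clone_algebra.select_convs .
  then show "primal (induced_algebra A {})"
    unfolding primal_def by (simp add: induced_algebra_def)
qed

section \<open>The equivalence\<close>

theorem theorem4p6:
  fixes A :: "'a clone_algebra"
  assumes "is_algebra A" and "finite (carrier A)"
  shows "(\<exists>\<U>. irredundant_cover A \<U> \<and> non_refinable_cover A \<U> \<and>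
              (\<forall>U\<in>\<U>. primal (induced_algebra A U)))
         \<longleftrightarrow> congruence_primal A \<and> arithmetical A"
proof (cases "carrier A = {}")
  case True
  then show ?thesis
    using empty_carrier_congruence_primal_arithmetical[OF assms(1)] empty_carrier_cover[OF assms(1)]
    by blast
next
  case False
  show ?thesis
  proof
    assume "\<exists>\<U>. irredundant_cover A \<U> \<and> non_refinable_cover A \<U> \<and>
      (\<forall>U\<in>\<U>. primal (induced_algebra A U))"
    then obtain \<U> where "cover A \<U>" "\<forall>U\<in>\<U>. primal (induced_algebra A U)"
      by (auto simp: irredundant_cover_def)
    then interpret primal_cover A \<U>
      using assms False by unfold_locales auto
    show "congruence_primal A \<and> arithmetical A" using congruence_primal arithmetical by simp
  next
    assume "congruence_primal A \<and> arithmetical A"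
    then interpret congruence_primal_arithmetical A
      using assms False by unfold_locales auto
    show "\<exists>\<U>. irredundant_cover A \<U> \<and> non_refinable_cover A \<U> \<and>
      (\<forall>U\<in>\<U>. primal (induced_algebra A U))"
      using primal_irredundant_non_refinable_cover by metis
  qed
qed

end
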